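(* Let $0<|q|<1$ and $z\in\mathbb{C}^*$ with $z\neq1$. Then $$(-zq,-1/z,q;q)_\infty\,F_4(z,-q)=\sum_{\substack{n,j\in\mathbb{Z}\\1\le j\le n}}q^{n^2-j(j-1)/2}\cdot\frac{z^n-z^{-n}}{1-z}.$$
   Context: Standard $q$-Pochhammer notation: $(a;q)_0=1$, $(a;q)_n=\prod_{k=0}^{n-1}(1-aq^k)$, $(a;q)_\infty=\prod_{k\ge0}(1-aq^k)$, $(a_1,\dots,a_m;q)_n=\prod_i(a_i;q)_n$. Define $$F_4(z,q)=\sum_{n=0}^{\infty}\frac{(-1)^n(q;-q)_{2n}\,q^{n+1}}{(zq,q/z;q^2)_{n+1}},$$ where $(q;-q)_{2n}=\prod_{k=0}^{2n-1}(1-q(-q)^k)$; $F_4(z,-q)$ denotes this with $q$ replaced by $-q$. *)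

theory Defs
  imports "HOL-Analysis.Analysis"
begin

definition qpoch :: "complex \<Rightarrow> complex \<Rightarrow> nat \<Rightarrow> complex" where
  "qpoch a q n = (\<Prod>k<n. 1 - a * q ^ k)"

definition qpoch_inf :: "complex \<Rightarrow> complex \<Rightarrow> complex" where
  "qpoch_inf a q = (\<Prod>k. 1 - a * q ^ k)"

text \<open>For \<open>norm q < 1\<close> the infinite product converges for every \<open>a\<close>, also when some
  of its factors vanish; \<^const>\<open>prodinf\<close> is then \<open>0\<close>, as it should be.\<close>

lemma convergent_prod_qpoch:
  assumes "norm q < 1"
  shows "convergent_prod (\<lambda>k. 1 - a * q ^ k :: complex)"
proof -
  have "summable (\<lambda>k. norm a * norm q ^ k)"
    using assms by (intro summable_mult summable_geometric) simp
  then have "summable (\<lambda>k. norm ((1 - a * q ^ k) - 1))"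
    by (simp add: norm_mult norm_power)
  then show ?thesis
    by (intro abs_convergent_prod_imp_convergent_prod)
       (simp add: abs_convergent_prod_conv_summable)
qed

definition qpochs :: "complex list \<Rightarrow> complex \<Rightarrow> nat \<Rightarrow> complex" where
  "qpochs as q n = (\<Prod>a\<leftarrow>as. qpoch a q n)"

definition qpochs_inf :: "complex list \<Rightarrow> complex \<Rightarrow> complex" where
  "qpochs_inf as q = (\<Prod>a\<leftarrow>as. qpoch_inf a q)"

definition F4_term :: "complex \<Rightarrow> complex \<Rightarrow> nat \<Rightarrow> complex" where
  "F4_term z q n =
     (-1) ^ n * qpoch q (- q) (2 * n) * q ^ (n + 1) / qpochs [z * q, q / z] (q ^ 2) (n + 1)"

definition F4 :: "complex \<Rightarrow> complex \<Rightarrow> complex" where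
  "F4 z q = (\<Sum>n. F4_term z q n)"

end

theory Submission
  imports Defs
begin

text \<open>
  Put \<open>x\<^sub>k = q\<^bsup>2k+1\<^esup>\<close> and \<open>D\<^sub>k = (1 + z x\<^sub>k) (1 + x\<^sub>k / z)\<close>. Expanding \<open>1 / (D\<^sub>0 \<dots> D\<^sub>n)\<close> into partial
  fractions and summing over \<open>n\<close> first, the inner sums are summable cases of the \<open>q\<close>-Gauss sum, and
  \<open>F4 z (- q)\<close> becomes a constant multiple of the Appell-Lerch sum over \<open>k\<close> of
  \<open>(-1)\<^sup>k q\<^bsup>(k+1)(k+1)\<^esup> (1 - x\<^sub>k) / D\<^sub>k\<close>. By the triple product identity the theta factor has a zero at
  each pole, so its quotient by \<open>1 + z x\<^sub>k\<close> has an everywhere convergent Laurent expansion; summing its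
  coefficients over \<open>k\<close> leaves the coefficients \<open>q\<^bsup>nn\<^esup> T(n)\<close> of the right-hand side, where
  \<open>T(n + 1) - T(n) = q\<^bsup>-n(n+1)/2\<^esup>\<close>, up to the factor \<open>\<Sum>N. (-1)\<^sup>N q\<^bsup>NN\<^esup>\<close>. This uses that the sum of
  \<open>(-1)\<^sup>N q\<^bsup>NN\<^esup> T(n + N)\<close> over all integers \<open>N\<close> is zero: \<open>T\<close> is odd, and increasing \<open>n\<close> by one changes
  the sum by a theta function at a zero.
\<close>

subsection \<open>The q-binomial theorem\<close>

text \<open>Write J(w) for the product in the triple product identity and x = q^(2k+1). Then J(z) =
  z J(1/z), and z/(1 + z x) - 1/(1 + x/z) = -(1 - z)(1 - x)/D_k. So each Lerch summand times theta
  is, up to the factor -(1 - z), the difference of one quotient J(w)/(1 + w x) at w = z and w = 1/z.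
  This is the source of z^n - z^(-n), and one family of Laurent coefficients suffices. The obstacle
  is that summing these coefficients over k yields only a half-line sum over N >= 1. The difference
  of the coefficients at n and -n, which the antisymmetry produces, supplies N <= -1, and the
  bilateral sum can be evaluated. The constant of the q-Gauss step is (-q;q)_inf / (q;q)_inf, the
  reciprocal of the sum of (-1)^N q^(N^2), so it cancels at the end.\<close>

lemma infsum_dominated_convergence:
  fixes f :: "nat \<Rightarrow> 'a \<Rightarrow> 'b :: banach"
  assumes bound: "\<And>n x. x \<in> A \<Longrightarrow> norm (f n x) \<le> M x"
    and M: "M summable_on A"
    and lim: "\<And>x. x \<in> A \<Longrightarrow> (\<lambda>n. f n x) \<longlonglongrightarrow> g x"
  shows "(\<lambda>n. \<Sum>\<^sub>\<infinity>x\<in>A. f n x) \<longlonglongrightarrow> (\<Sum>\<^sub>\<infinity>x\<in>A. g x)"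
\<comment> \<open>The M-test makes the finite partial sums converge uniformly in \<open>n\<close>,
  so the limits over finite sets and over \<open>n\<close> commute.\<close>
proof (rule swap_uniform_limit')
  have "norm (g x) \<le> M x" if "x \<in> A" for x
    by (rule tendsto_upperbound[OF tendsto_norm[OF lim[OF that]]]) (use bound that in auto)
  then have "g abs_summable_on A"
    by (rule Infinite_Sum.abs_summable_on_comparison_test'[OF M])
  then show "((\<lambda>X. \<Sum>x\<in>X. g x) \<longlongrightarrow> (\<Sum>\<^sub>\<infinity>x\<in>A. g x)) (finite_subsets_at_top A)"
    by (rule infsum_tendsto[OF abs_summable_summable])
  show "\<forall>\<^sub>F X in finite_subsets_at_top A. (\<lambda>n. \<Sum>x\<in>X. f n x) \<longlonglongrightarrow> (\<Sum>x\<in>X. g x)"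
    by (rule eventually_finite_subsets_at_top_weakI) (intro tendsto_sum lim, auto)
  show "uniform_limit UNIV (\<lambda>X n. \<Sum>x\<in>X. f n x) (\<lambda>n. \<Sum>\<^sub>\<infinity>x\<in>A. f n x) (finite_subsets_at_top A)"
    by (rule Weierstrass_m_test_general[OF bound M])
qed auto

lemma qpoch_0 [simp]: "qpoch a q 0 = 1"
  and qpoch_Suc: "qpoch a q (Suc n) = qpoch a q n * (1 - a * q ^ n)"
  by (simp_all add: qpoch_def)

lemma qpoch_tendsto:
  assumes "norm q < 1"
  shows "qpoch a q \<longlonglongrightarrow> qpoch_inf a q"
proof -
  have "(\<lambda>n. qpoch a q (Suc n)) \<longlonglongrightarrow> qpoch_inf a q"
    using convergent_prod_LIMSEQ[OF convergent_prod_qpoch[OF assms, of a]]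
    by (simp add: qpoch_def qpoch_inf_def lessThan_Suc_atMost)
  then show ?thesis
    by (rule LIMSEQ_imp_Suc)
qed

lemma qpoch_factor_nonzero:
  fixes a q :: complex
  assumes "norm q < 1" "norm a < 1"
  shows "1 - a * q ^ k \<noteq> 0"
proof
  assume "1 - a * q ^ k = 0"
  then have "a * q ^ k = 1" by simp
  then have "norm a * norm q ^ k = 1" by (metis norm_mult norm_power norm_one)
  moreover have "norm a * norm q ^ k \<le> norm a * 1"
    using assms by (intro mult_left_mono power_le_one) auto
  ultimately show False using assms by simp
qed

lemma qpoch_nonzero:
  assumes "norm q < 1" "norm a < 1"
  shows "qpoch a q n \<noteq> 0"
  using qpoch_factor_nonzero[OF assms] by (simp add: qpoch_def)

lemma qpoch_inf_nonzero:
  assumes "norm q < 1" "norm a < 1"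
  shows "qpoch_inf a q \<noteq> 0"
  unfolding qpoch_inf_def
  by (rule prodinf_nonzero[OF convergent_prod_qpoch]) (use qpoch_factor_nonzero[OF assms] assms in auto)

lemma qpoch_bounded:
  assumes "norm q < 1"
  obtains C where "C > 0" "\<And>n. norm (qpoch a q n) \<le> C"
  using qpoch_tendsto[OF assms] by (metis convergentI convergent_imp_Bseq BseqE)

lemma inverse_qpoch_bounded:
  assumes "norm q < 1" "norm a < 1"
  obtains C where "C > 0" "\<And>n. norm (inverse (qpoch a q n)) \<le> C"
  using tendsto_inverse[OF qpoch_tendsto[OF assms(1)] qpoch_inf_nonzero[OF assms]]
  by (metis convergentI convergent_imp_Bseq BseqE)

lemma Suc_choose_two: "Suc n choose 2 = (n choose 2) + n"
  by (simp add: numeral_2_eq_2)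

text \<open>Induction by splitting off the factor \<open>i = 0\<close>, which leaves the product at
  \<open>x * q\<close>; comparing coefficients is then the q-Pascal rule.\<close>

theorem q_binomial:
  fixes q x :: complex
  assumes q: "norm q < 1"
  shows "(\<Prod>i<n. 1 + x * q ^ i) =
    (\<Sum>j\<le>n. qpoch q q n / (qpoch q q j * qpoch q q (n - j)) * q ^ (j choose 2) * x ^ j)"
proof (induction n arbitrary: x)
  case 0
  then show ?case by (simp add: binomial_eq_0)
next
  case (Suc n)
  note nz = qpoch_nonzero[OF q q]
  \<comment> \<open>The Gaussian binomial, extended by 0 for \<open>j > n\<close> so that
    \<open>f (Suc n) = 0\<close> closes the index shift.\<close>
  define b where "b n j = (if j \<le> n then qpoch q q n / (qpoch q q j * qpoch q q (n - j)) else 0)" for n j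
  define f where "f j = b n j * q ^ (j choose 2) * q ^ j * x ^ j" for j
  have step: "b (Suc n) (Suc j) * q ^ (Suc j choose 2) * x ^ Suc j = f (Suc j) + x * f j"
    if "j \<le> n" for j
  proof (cases "j = n")
    case True
    then show ?thesis using nz by (simp add: b_def f_def Suc_choose_two power_add)
  next
    case False
    with that have "n = Suc (j + (n - Suc j))" by simp
    then obtain m where m: "n = Suc (j + m)" by blast
    have nz': "1 - q * q ^ k \<noteq> 0" for k by (rule qpoch_factor_nonzero[OF q q])
    define u v w where "u = qpoch q q j" and "v = qpoch q q m" and "w = qpoch q q (Suc (j + m))"
    have uv: "u \<noteq> 0" "v \<noteq> 0" using nz by (auto simp: u_def v_def)
    define c d where "c = 1 - q * q ^ j" and "d = 1 - q * q ^ m"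
    have cd: "c \<noteq> 0" "d \<noteq> 0" using nz' by (auto simp: c_def d_def)
    \<comment> \<open>The q-Pascal rule in cleared form: 1 - q^(j+m+2) = q^(j+1) (1 - q^(m+1)) + (1
      - q^(j+1)).\<close>
    have "1 - q * q ^ Suc (j + m) = q ^ Suc j * d + c"
      by (simp add: c_def d_def algebra_simps power_add)
    moreover have "w * (e * d + c) / ((u * c) * (v * d)) = e * (w / (u * c * v)) + w / (u * (v * d))" for e
      using uv cd by (simp add: field_simps)
    ultimately have "w * (1 - q * q ^ Suc (j + m)) / ((u * c) * (v * d))
        = q ^ Suc j * (w / (u * c * v)) + w / (u * (v * d))"
      by simp
    then have "b (Suc n) (Suc j) = q ^ Suc j * b n (Suc j) + b n j"
      unfolding m b_def u_def v_def w_def c_def d_def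
      by (simp add: qpoch_Suc Suc_diff_le)
    then show ?thesis
      by (simp add: f_def Suc_choose_two power_add algebra_simps)
  qed
  have "f (Suc n) = 0" by (simp add: f_def b_def)
  then have "(\<Sum>j\<le>n. f j) = (\<Sum>j\<le>Suc n. f j)" by simp
  then have shift: "(\<Sum>j\<le>n. f j) = f 0 + (\<Sum>j\<le>n. f (Suc j))"
    by (simp only: sum.atMost_Suc_shift)
  have IH: "(\<Prod>i<n. 1 + (x * q) * q ^ i) = (\<Sum>j\<le>n. f j)"
    unfolding Suc.IH by (rule sum.cong) (auto simp: f_def b_def power_mult_distrib)
  have "(\<Prod>i<Suc n. 1 + x * q ^ i) = (1 + x) * (\<Prod>i<n. 1 + (x * q) * q ^ i)"
    by (simp add: prod.lessThan_Suc_shift mult.assoc del: prod.lessThan_Suc)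
  also have "\<dots> = f 0 + ((\<Sum>j\<le>n. f (Suc j)) + (\<Sum>j\<le>n. x * f j))"
    unfolding IH distrib_right by (subst shift) (simp add: sum_distrib_left)
  also have "\<dots> = f 0 + (\<Sum>j\<le>n. b (Suc n) (Suc j) * q ^ (Suc j choose 2) * x ^ Suc j)"
    unfolding sum.distrib[symmetric] by (intro arg_cong2[of _ _ _ _ "(+)"] refl sum.cong) (simp only: step atMost_iff)
  also have "\<dots> = (\<Sum>j\<le>Suc n. b (Suc n) j * q ^ (j choose 2) * x ^ j)"
    unfolding sum.atMost_Suc_shift using nz by (simp add: f_def b_def binomial_eq_0)
  also have "\<dots> = (\<Sum>j\<le>Suc n. qpoch q q (Suc n) / (qpoch q q j * qpoch q q (Suc n - j)) * q ^ (j choose 2) * x ^ j)"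
    by (rule sum.cong) (simp_all only: b_def atMost_iff if_True)
  finally show ?case .
qed

subsection \<open>Partial fractions\<close>

text \<open>The binomial coefficient n choose 2 continued to negative integers, as bilateral theta
  series require. Many exponent identities below are proved after doubling, where
  \<open>tri_double\<close> removes the division.\<close>

definition tri :: "int \<Rightarrow> int" where "tri n = n * (n - 1) div 2"

lemma tri_double: "2 * tri n = n * (n - 1)"
  by (simp add: tri_def)

lemma tri_0 [simp]: "tri 0 = 0"
  by (simp add: tri_def)

lemma tri_add: "tri (m + n) = tri m + tri n + m * n"
proof -
  have "2 * tri (m + n) = 2 * (tri m + tri n + m * n)"
    unfolding tri_double distrib_left by (simp add: algebra_simps)
  then show ?thesis by simp
qed

lemma tri_minus: "tri (- n) = tri n + n"
proof -
  have "2 * tri (- n) = 2 * (tri n + n)"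
    unfolding tri_double distrib_left by (simp add: algebra_simps)
  then show ?thesis by simp
qed

lemma tri_1 [simp]: "tri 1 = 0"
  by (simp add: tri_def)

lemma tri_Suc: "tri (n + 1) = tri n + n"
  by (simp add: tri_add)

lemma tri_of_nat: "int (n choose 2) = tri (int n)"
  by (induction n) (simp_all add: Suc_choose_two tri_add binomial_eq_0 add.commute[of 1])

lemma tri_square: "n ^ 2 = 2 * tri n + n"
  unfolding tri_double by (simp add: power2_eq_square algebra_simps)

text \<open>Pairs the terms symmetric about the midpoint N + 1/2; in the next lemma the two terms of
  a pair share one denominator.\<close>

lemma sum_fold_middle:
  fixes f :: "nat \<Rightarrow> 'a :: comm_monoid_add"
  shows "(\<Sum>j\<le>2 * N + 1. f j) = (\<Sum>k\<le>N. f (N - k) + f (N + 1 + k))"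
proof (induction N arbitrary: f)
  case (Suc N)
  have "(\<Sum>j\<le>2 * Suc N + 1. f j) = f 0 + (\<Sum>j\<le>Suc (2 * N + 1). f (Suc j))"
    using sum.atMost_Suc_shift[of f "Suc (2 * N + 1)"] by simp
  also have "\<dots> = f 0 + ((\<Sum>j\<le>2 * N + 1. f (Suc j)) + f (2 * N + 3))"
    by (simp add: numeral_3_eq_3)
  also have "(\<Sum>j\<le>2 * N + 1. f (Suc j)) = (\<Sum>k\<le>N. f (Suc N - k) + f (Suc N + 1 + k))"
    unfolding Suc.IH by (rule sum.cong) (auto simp: Suc_diff_le)
  also have "f 0 + ((\<Sum>k\<le>N. f (Suc N - k) + f (Suc N + 1 + k)) + f (2 * N + 3))
      = (\<Sum>k\<le>Suc N. f (Suc N - k) + f (Suc N + 1 + k))"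
    by (simp add: ac_simps mult_2 mult_2_right numeral_3_eq_3)
  finally show ?case .
qed simp

text \<open>The q-binomial theorem for 2N + 1 factors at a zero of the product, folded about the
  middle. This cancellation closes the induction in \<open>partial_fractions\<close>.\<close>

lemma alternating_q_binomial_sum:
  fixes p :: complex
  assumes p: "p \<noteq> 0" "norm p < 1" and N: "N \<ge> 1"
  shows "(\<Sum>k\<le>N. (- 1) ^ k * p ^ (k choose 2) * (1 - p ^ (2 * k + 1))
      / (qpoch p p (N - k) * qpoch p p (N + k + 1))) = 0"
proof -
  \<comment> \<open>Makes the factor \<open>i = N + 1\<close> vanish; it is among the
    \<open>2 * N + 1\<close> factors because \<open>N \<ge> 1\<close>.\<close>
  define x where "x = - (p powi (- int (N + 1)))"
  define P where "P = qpoch p p (2 * N + 1)"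
  \<comment> \<open>\<open>- tri (int N + 2)\<close> is the exponent of \<open>p\<close> in the
    middle term \<open>j = N + 1\<close>, that is \<open>k = 0\<close>; every pair contains this
    power.\<close>
  define C where "C = (- 1) ^ N * P * p powi (- tri (int N + 2))"
  define f where "f j = P / (qpoch p p j * qpoch p p (2 * N + 1 - j)) * p ^ (j choose 2) * x ^ j" for j
  have P: "P \<noteq> 0" unfolding P_def by (rule qpoch_nonzero[OF p(2) p(2)])
  have pow: "p ^ (j choose 2) * x ^ j = (- 1) ^ j * p powi (tri (int j) - int (N + 1) * int j)" for j
  proof -
    have "x ^ j = (- 1) ^ j * p powi (- int (N + 1) * int j)"
      unfolding x_def power_minus[of "p powi _"] by (simp add: power_int_power')
    moreover have "p ^ (j choose 2) = p powi tri (int j)"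
      by (simp add: tri_of_nat[symmetric])
    moreover have "tri (int j) - int (N + 1) * int j = tri (int j) + - int (N + 1) * int j"
      by (simp add: algebra_simps)
    ultimately show ?thesis
      using p by (simp only: power_int_add simp_thms mult_ac)
  qed
  have "(\<Prod>i<2 * N + 1. 1 + x * p ^ i) = 0"
  proof (rule prod_zero)
    have "x * p ^ (N + 1) = - 1"
      using p unfolding x_def by (simp add: power_int_minus field_simps del: of_nat_Suc of_nat_add)
    then show "\<exists>i\<in>{..<2 * N + 1}. 1 + x * p ^ i = 0"
      using N by (intro bexI[of _ "N + 1"]) auto
  qed simp
  then have "0 = (\<Sum>j\<le>2 * N + 1. f j)"
    unfolding f_def P_def by (simp add: q_binomial[OF p(2)])
  also have "\<dots> = (\<Sum>k\<le>N. f (N - k) + f (N + 1 + k))"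
    by (rule sum_fold_middle)
  also have "\<dots> = (\<Sum>k\<le>N. - C * ((- 1) ^ k * p ^ (k choose 2) * (1 - p ^ (2 * k + 1))
      / (qpoch p p (N - k) * qpoch p p (N + k + 1))))"
  proof (rule sum.cong[OF refl])
    fix k assume "k \<in> {..N}"
    then have k: "k \<le> N" by simp
    define d where "d = qpoch p p (N - k) * qpoch p p (N + k + 1)"
    have e1: "tri (int (N - k)) - int (N + 1) * int (N - k) = - tri (int N + 2) + tri (int k) + int (2 * k + 1)"
    proof -
      have "2 * (tri (int (N - k)) - int (N + 1) * int (N - k)) = 2 * (- tri (int N + 2) + tri (int k) + int (2 * k + 1))"
        unfolding right_diff_distrib distrib_left mult_minus_right tri_double
        using k by (simp add: of_nat_diff algebra_simps)
      then show ?thesis by simp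
    qed
    have e2: "tri (int (N + 1 + k)) - int (N + 1) * int (N + 1 + k) = - tri (int N + 2) + tri (int k)"
    proof -
      have "2 * (tri (int (N + 1 + k)) - int (N + 1) * int (N + 1 + k)) = 2 * (- tri (int N + 2) + tri (int k))"
        unfolding right_diff_distrib distrib_left mult_minus_right tri_double
        by (simp add: algebra_simps)
      then show ?thesis by simp
    qed
    have pk: "p powi tri (int k) = p ^ (k choose 2)"
      by (simp add: tri_of_nat[symmetric])
    have p2: "p powi (- tri (int N + 2) + tri (int k)) = p powi (- tri (int N + 2)) * p ^ (k choose 2)"
      by (subst power_int_add) (use p pk in auto)
    have p1: "p powi (- tri (int N + 2) + tri (int k) + int (2 * k + 1))
        = p powi (- tri (int N + 2)) * p ^ (k choose 2) * p ^ (2 * k + 1)"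
      by (subst power_int_add) (use p p2 in \<open>auto simp del: of_nat_add of_nat_Suc of_nat_mult\<close>)
    have "(- 1) ^ (N - k) = (- 1 :: complex) ^ (N + k)"
      using k by (simp add: minus_one_power_iff)
    moreover have "2 * N + 1 - (N - k) = N + k + 1" "2 * N + 1 - (N + 1 + k) = N - k"
      using k by auto
    ultimately have "f (N - k) = P / d * ((- 1) ^ (N + k) * (p powi (- tri (int N + 2)) * p ^ (k choose 2) * p ^ (2 * k + 1)))"
      and "f (N + 1 + k) = P / d * (- ((- 1) ^ (N + k)) * (p powi (- tri (int N + 2)) * p ^ (k choose 2)))"
      unfolding f_def d_def mult.assoc pow e1 e2 p1 p2 by (simp_all add: ac_simps)
    then show "f (N - k) + f (N + 1 + k) = - C * ((- 1) ^ k * p ^ (k choose 2) * (1 - p ^ (2 * k + 1)) / d)"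
      unfolding C_def by (simp add: power_add algebra_simps add_divide_distrib diff_divide_distrib)
  qed
  also have "\<dots> = - C * (\<Sum>k\<le>N. (- 1) ^ k * p ^ (k choose 2) * (1 - p ^ (2 * k + 1))
      / (qpoch p p (N - k) * qpoch p p (N + k + 1)))"
    by (rule sum_distrib_left[symmetric])
  finally show ?thesis
    using P p by (auto simp: C_def)
qed

text \<open>Each D_k is 1 + x_k^2 + x_k (z + 1/z), so x_k D_N - x_N D_k is free of z and 1/(D_k D_N)
  splits into multiples of 1/D_k and 1/D_N. In the induction this gives the coefficients for k < N
  directly; the one of 1/D_N follows from \<open>alternating_q_binomial_sum\<close>.\<close>

lemma partial_fractions:
  fixes q z :: complex
  assumes q: "q \<noteq> 0" "norm q < 1" and z: "z \<noteq> 0"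
  defines "D \<equiv> (\<lambda>k. (1 + z * q ^ (2 * k + 1)) * (1 + q ^ (2 * k + 1) / z))"
  assumes D: "\<And>k. D k \<noteq> 0"
  shows "1 / (\<Prod>k\<le>n. D k) = (\<Sum>k\<le>n. (- 1) ^ k * (q ^ 2) ^ (Suc k choose 2) *
      (1 - q ^ (4 * k + 2)) / (qpoch (q^2) (q^2) (n - k) * qpoch (q^2) (q^2) (n + k + 1)) / D k)"
proof (induction n)
  case 0
  have "norm (q ^ 2) < 1" using q by (simp add: norm_power power_less_one_iff)
  then have "q ^ 2 \<noteq> 1" by auto
  then show ?case by (simp add: qpoch_Suc binomial_eq_0 power2_eq_square)
next
  case (Suc n)
  define p where "p = q ^ 2"
  define x where "x k = q ^ (2 * k + 1)" for k
  define c where "c n k = (- 1) ^ k * p ^ (Suc k choose 2) * (1 - q ^ (4 * k + 2)) /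
     (qpoch p p (n - k) * qpoch p p (n + k + 1))" for n k :: nat
  define N where "N = Suc n"
  have p: "p \<noteq> 0" "norm p < 1" using q by (auto simp: p_def norm_power power_less_one_iff)
  have x0: "x k \<noteq> 0" for k using q by (simp add: x_def)
  have xp: "x k = q * p ^ k" for k by (simp add: x_def p_def power_mult power_add)
  have Dx: "D k = 1 + x k ^ 2 + x k * (z + 1 / z)" for k
    using z by (simp add: D_def x_def power2_eq_square field_simps)
  have step: "c n k / D k / D N = c N k / D k - x N / D N * (c N k / x k)" if k: "k \<le> n" for k
  proof -
    define a b where "a = 1 - p * p ^ (n - k)" and "b = 1 - p * p ^ (n + k + 1)"
    have ab: "a \<noteq> 0" "b \<noteq> 0" unfolding a_def b_def by (rule qpoch_factor_nonzero[OF p(2) p(2)])+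
    have "x N = x k * (p * p ^ (n - k))"
      using k by (simp add: xp N_def mult.assoc power_add[symmetric] flip: power_Suc)
    then have 1: "x k - x N = x k * a" by (simp add: a_def algebra_simps)
    have "x k * x N = p * p ^ (n + k + 1)"
      by (simp add: xp N_def power_add power2_eq_square p_def ac_simps)
    then have 2: "1 - x k * x N = b" by (simp add: b_def)
    \<comment> \<open>Here z + 1/z cancels. Up to \<open>x k\<close>, the two factors are those by
      which the denominator of \<open>c n k\<close> grows in passing to \<open>N\<close>.\<close>
    have "x k * D N - x N * D k = (x k - x N) * (1 - x k * x N)"
      unfolding Dx by (simp add: power2_eq_square algebra_simps)
    then have "x k * D N - x N * D k = x k * (a * b)" by (simp add: 1 2)
    moreover have "1 / D k - x N / x k / D N = (x k * D N - x N * D k) / (x k * (D k * D N))"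
      using x0[of k] D[of k] D[of N] by (simp add: divide_simps)
    ultimately have "1 / (a * b) * (1 / D k - x N / x k / D N) = 1 / (D k * D N)"
      using ab x0[of k] by simp
    moreover have "c N k = c n k * (1 / (a * b))"
      using k by (simp add: c_def N_def a_def b_def qpoch_Suc Suc_diff_le mult.assoc)
    ultimately have "c n k * (1 / (D k * D N)) = c N k * (1 / D k - x N / x k / D N)"
      by (metis mult.assoc)
    then show ?thesis
      by (simp add: right_diff_distrib mult.commute)
  qed
  have "(\<Sum>k\<le>N. c N k / x k) = (\<Sum>k\<le>N. (- 1) ^ k * p ^ (k choose 2) * (1 - p ^ (2 * k + 1))
      / (qpoch p p (N - k) * qpoch p p (N + k + 1))) / q"
    unfolding sum_divide_distrib
  proof (rule sum.cong[OF refl])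
    fix k
    have "q ^ (4 * k + 2) = p ^ (2 * k + 1)"
      unfolding p_def power_mult[symmetric] by (rule arg_cong[of _ _ "(^) q"]) simp
    moreover have "p ^ (Suc k choose 2) / x k = p ^ (k choose 2) / q"
      using p by (simp add: xp Suc_choose_two power_add)
    moreover have "c N k / x k = (- 1) ^ k * (p ^ (Suc k choose 2) / x k) * (1 - q ^ (4 * k + 2))
      / (qpoch p p (N - k) * qpoch p p (N + k + 1))"
      by (simp add: c_def)
    ultimately show "c N k / x k = (- 1) ^ k * p ^ (k choose 2) * (1 - p ^ (2 * k + 1))
      / (qpoch p p (N - k) * qpoch p p (N + k + 1)) / q"
      by simp
  qed
  \<comment> \<open>Determines the accumulated coefficient of 1/D_N without summing it.\<close>
  then have zero: "(\<Sum>k\<le>n. c N k / x k) + c N N / x N = 0"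
    using alternating_q_binomial_sum[OF p, of N] by (simp add: N_def)
  have "1 / (\<Prod>k\<le>N. D k) = 1 / (\<Prod>k\<le>n. D k) / D N"
    by (simp add: N_def)
  also have "1 / (\<Prod>k\<le>n. D k) = (\<Sum>k\<le>n. c n k / D k)"
    unfolding Suc.IH by (simp add: c_def p_def)
  also have "\<dots> / D N = (\<Sum>k\<le>n. c N k / D k) - x N / D N * (\<Sum>k\<le>n. c N k / x k)"
    unfolding sum_divide_distrib sum_distrib_left sum_subtractf[symmetric]
    by (rule sum.cong) (simp_all only: step atMost_iff)
  also have "(\<Sum>k\<le>n. c N k / x k) = - (c N N / x N)"
    using zero by (simp add: eq_neg_iff_add_eq_0)
  also have "(\<Sum>k\<le>n. c N k / D k) - x N / D N * - (c N N / x N) = (\<Sum>k\<le>N. c N k / D k)"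
    using x0[of N] by (simp add: N_def)
  finally show ?case
    by (simp add: c_def p_def N_def)
qed

subsection \<open>The triple product identity\<close>

lemma summable_on_int:
  fixes f :: "int \<Rightarrow> real"
  assumes "summable (\<lambda>n. f (int n))" "summable (\<lambda>n. f (- int n))" "\<And>n. f n \<ge> 0"
  shows "f summable_on UNIV"
proof -
  have "f summable_on range (\<lambda>n. int n)"
    using assms by (subst summable_on_reindex) (auto simp: o_def inj_on_def intro!: summable_nonneg_imp_summable_on)
  moreover have "f summable_on range (\<lambda>n. - int n)"
    using assms by (subst summable_on_reindex) (auto simp: o_def inj_on_def intro!: summable_nonneg_imp_summable_on)
  ultimately have "f summable_on (range (\<lambda>n. int n) \<union> range (\<lambda>n. - int n))"
    by (rule summable_on_union)
  moreover have "x \<in> range (\<lambda>n. int n) \<union> range (\<lambda>n. - int n)" for x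
    by (cases x rule: int_cases2) auto
  then have "range (\<lambda>n. int n) \<union> range (\<lambda>n. - int n) = UNIV" by blast
  ultimately show ?thesis by simp
qed

lemma prod_lessThan_add:
  fixes f :: "nat \<Rightarrow> 'a :: comm_monoid_mult"
  shows "(\<Prod>i<m + n. f i) = (\<Prod>i<m. f i) * (\<Prod>i<n. f (i + m))"
  by (induction n) (simp_all add: ac_simps)

text \<open>Consecutive terms have ratio x r^n, which tends to 0 for every real x.\<close>

lemma summable_power_choose_two:
  fixes x r :: real
  assumes "0 \<le> r" "r < 1"
  shows "summable (\<lambda>n. x ^ n * r ^ (n choose 2))"
proof -
  have "(\<lambda>n. \<bar>x\<bar> * r ^ n) \<longlonglongrightarrow> \<bar>x\<bar> * 0"
    by (intro tendsto_mult tendsto_const LIMSEQ_power_zero) (use assms in auto)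
  then have "eventually (\<lambda>n. \<bar>x\<bar> * r ^ n < 1 / 2) sequentially"
    by (intro order_tendstoD(2)) auto
  then obtain N where N: "\<And>n. n \<ge> N \<Longrightarrow> \<bar>x\<bar> * r ^ n < 1 / 2"
    by (auto simp: eventually_sequentially)
  show ?thesis
  proof (rule summable_ratio_test[of "1/2" N])
    fix n assume "n \<ge> N"
    have "norm (x ^ Suc n * r ^ (Suc n choose 2)) = (\<bar>x\<bar> * r ^ n) * norm (x ^ n * r ^ (n choose 2))"
      using assms by (simp add: Suc_choose_two power_add abs_mult)
    also have "\<dots> \<le> 1 / 2 * norm (x ^ n * r ^ (n choose 2))"
      by (rule mult_right_mono) (use N[OF \<open>n \<ge> N\<close>] in auto)
    finally show "norm (x ^ Suc n * r ^ (Suc n choose 2)) \<le> 1 / 2 * norm (x ^ n * r ^ (n choose 2))" .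
  qed auto
qed

lemma theta_summable_real:
  fixes x r :: real
  assumes "x > 0" "0 < r" "r < 1"
  shows "(\<lambda>n. x powi n * r powi tri n) summable_on UNIV"
proof (rule summable_on_int)
  have nat: "r powi tri (int n) = r ^ (n choose 2)" for n
    by (simp add: tri_of_nat[symmetric])
  show "summable (\<lambda>n. x powi int n * r powi tri (int n))"
    using assms by (simp add: nat summable_power_choose_two)
  have "x powi - int n * r powi tri (- int n) = (r / x) ^ n * r ^ (n choose 2)" for n
    using assms by (simp add: tri_minus power_int_add nat power_int_minus power_divide field_simps)
  then show "summable (\<lambda>n. x powi - int n * r powi tri (- int n))"
    using assms by (simp add: summable_power_choose_two)
qed (use assms in auto)

context
  fixes q :: complex
  assumes q0: "q \<noteq> 0" and q1: "norm q < 1"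
begin

lemma q_powi_add: "q powi (a + b) = q powi a * q powi b"
  using q0 by (simp add: power_int_add)

lemma theta_abs_summable:
  fixes z :: complex
  assumes "z \<noteq> 0"
  shows "(\<lambda>n. norm (z powi n * q powi tri n)) summable_on UNIV"
  using theta_summable_real[of "norm z" "norm q"] assms q0 q1
  by (simp add: norm_mult norm_power_int)

text \<open>The q-binomial theorem for 2N factors with argument w q^(-N): the upper N factors give
  \<open>qpoch (- w) q N\<close>, and the lower N, read backwards, give
  \<open>qpoch (- q / w) q N\<close> up to a monomial.\<close>

lemma finite_jacobi_triple_product:
  assumes w: "w \<noteq> 0"
  shows "qpoch (- w) q N * qpoch (- q / w) q N = (\<Sum>m=-int N..int N.
     qpoch q q (2 * N) / (qpoch q q (nat (int N + m)) * qpoch q q (nat (int N - m))) * (w powi m * q powi tri m))"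
proof -
  define x where "x = w * q powi (- int N)"
  have "(\<Prod>i<2 * N. 1 + x * q ^ i) = (\<Prod>i<N. 1 + x * q ^ i) * (\<Prod>i<N. 1 + x * q ^ (i + N))"
    unfolding mult_2 by (rule prod_lessThan_add)
  also have "(\<Prod>i<N. 1 + x * q ^ (i + N)) = qpoch (- w) q N"
    using q0 by (simp add: qpoch_def x_def power_add power_int_minus field_simps)
  also have "(\<Prod>i<N. 1 + x * q ^ i) = (\<Prod>i<N. 1 + x * q ^ (N - Suc i))"
    by (rule prod.nat_diff_reindex[symmetric])
  also have "\<dots> = (\<Prod>i<N. w * q powi (- int (Suc i)) * (1 + q * q ^ i / w))"
  proof (rule prod.cong[OF refl])
    fix i assume "i \<in> {..<N}"
    then have "q powi (- int N) * q ^ (N - Suc i) = q powi (- int (Suc i))"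
      using q0 by (simp add: power_int_of_nat[symmetric] power_int_add[symmetric] of_nat_diff del: power_int_of_nat)
    then have "1 + x * q ^ (N - Suc i) = 1 + w * q powi (- int (Suc i))"
      by (simp add: x_def mult.assoc)
    also have "\<dots> = w * q powi (- int (Suc i)) * (1 + q * q ^ i / w)"
    proof -
      have "q powi (- int (Suc i)) = 1 / (q * q ^ i)"
        unfolding power_int_minus_divide power_int_of_nat by simp
      then show ?thesis
        using q0 w by (simp add: field_simps)
    qed
    finally show "1 + x * q ^ (N - Suc i) = \<dots>" .
  qed
  also have "\<dots> = (\<Prod>i<N. w * q powi (- int (Suc i))) * qpoch (- q / w) q N"
    by (simp add: prod.distrib qpoch_def)
  \<comment> \<open>The same monomial appears in every term on the other side after the index shift
    j = N + m, and cancels.\<close>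
  also have "(\<Prod>i<N. w * q powi (- int (Suc i))) = w powi int N * q powi (- tri (int N + 1))"
  proof (induction N)
    case (Suc N)
    have "tri (int (Suc N) + 1) = tri (int N + 1) + int (Suc N)"
      using tri_Suc[of "int N + 1"] by (simp add: ac_simps)
    then have "q powi (- tri (int (Suc N) + 1)) = q powi (- tri (int N + 1)) * q powi (- int (Suc N))"
      by (simp only: minus_add_distrib q_powi_add)
    moreover have "w powi int (Suc N) = w * w powi int N"
      unfolding power_int_of_nat by simp
    ultimately show ?case using Suc.IH by (simp only: prod.lessThan_Suc mult_ac)
  qed simp
  finally have "(\<Prod>i<2 * N. 1 + x * q ^ i) =
      w powi int N * q powi (- tri (int N + 1)) * (qpoch (- w) q N * qpoch (- q / w) q N)"
    by (simp only: mult_ac)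
  then have "w powi int N * q powi (- tri (int N + 1)) * (qpoch (- w) q N * qpoch (- q / w) q N) =
      (\<Sum>j\<le>2 * N. qpoch q q (2 * N) / (qpoch q q j * qpoch q q (2 * N - j)) * q ^ (j choose 2) * x ^ j)"
    unfolding q_binomial[OF q1] by (rule sym)
  also have "\<dots> = (\<Sum>m=-int N..int N. w powi int N * q powi (- tri (int N + 1)) *
      (qpoch q q (2 * N) / (qpoch q q (nat (int N + m)) * qpoch q q (nat (int N - m))) * (w powi m * q powi tri m)))"
  proof (rule sum.reindex_bij_witness[of _ "\<lambda>m. nat (int N + m)" "\<lambda>j. int j - int N"])
    fix j assume j: "j \<in> {..2 * N}"
    have "2 * (tri (int j) - int N * int j) = 2 * (- tri (int N + 1) + tri (int j - int N))"
      unfolding right_diff_distrib distrib_left mult_minus_right tri_double by (simp add: algebra_simps)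
    then have "tri (int j) + (- int N) * int j = - tri (int N + 1) + tri (int j - int N)"
      by simp
    then have 1: "q powi (tri (int j)) * q powi ((- int N) * int j) = q powi (- tri (int N + 1)) * q powi tri (int j - int N)"
      by (simp only: q_powi_add[symmetric])
    have 2: "x ^ j = w ^ j * q powi ((- int N) * int j)"
      by (simp add: x_def power_mult_distrib power_int_power')
    have 3: "q ^ (j choose 2) = q powi tri (int j)"
      by (simp add: tri_of_nat[symmetric])
    have 4: "w ^ j = w powi int N * w powi (int j - int N)"
      using w by (simp add: power_int_diff)
    have "q ^ (j choose 2) * x ^ j = w ^ j * (q powi (tri (int j)) * q powi ((- int N) * int j))"
      unfolding 2 3 by (simp only: mult_ac)
    also have "\<dots> = w powi int N * q powi (- tri (int N + 1)) * (w powi (int j - int N) * q powi tri (int j - int N))"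
      unfolding 1 4 by (simp only: mult_ac)
    finally have "q ^ (j choose 2) * x ^ j
        = w powi int N * q powi (- tri (int N + 1)) * (w powi (int j - int N) * q powi tri (int j - int N))" .
    moreover have "nat (int N + (int j - int N)) = j" "nat (int N - (int j - int N)) = 2 * N - j"
      using j by auto
    ultimately show "w powi int N * q powi (- tri (int N + 1)) *
      (qpoch q q (2 * N) / (qpoch q q (nat (int N + (int j - int N))) * qpoch q q (nat (int N - (int j - int N))))
        * (w powi (int j - int N) * q powi tri (int j - int N)))
      = qpoch q q (2 * N) / (qpoch q q j * qpoch q q (2 * N - j)) * q ^ (j choose 2) * x ^ j"
      by (simp only: mult.assoc) (simp only: mult_ac)
  qed auto
  finally show ?thesis
    unfolding sum_distrib_left[symmetric] by (rule mult_left_cancel[THEN iffD1, rotated]) (use w q0 in auto)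
qed

text \<open>Limit of the finite identity: the weights tend to 1 / \<open>qpoch_inf q q\<close> and
  are uniformly bounded, so a multiple of the absolute theta series is a majorant.\<close>

theorem jacobi_triple_product:
  assumes w: "w \<noteq> 0"
  shows "((\<lambda>m. w powi m * q powi tri m) has_sum
    qpoch_inf (- w) q * qpoch_inf (- q / w) q * qpoch_inf q q) UNIV"
proof -
  define t where "t m = w powi m * q powi tri m" for m
  define f where "f N m = (if m \<in> {-int N..int N} then qpoch q q (2 * N) /
     (qpoch q q (nat (int N + m)) * qpoch q q (nat (int N - m))) * t m else 0)" for N m
  obtain C where C: "C > 0" "\<And>n. norm (qpoch q q n) \<le> C"
    using qpoch_bounded[OF q1] by blast
  obtain D where D: "D > 0" "\<And>n. norm (inverse (qpoch q q n)) \<le> D"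
    using inverse_qpoch_bounded[OF q1 q1] by blast
  have nz: "qpoch_inf q q \<noteq> 0" by (rule qpoch_inf_nonzero[OF q1 q1])
  have t: "(\<lambda>m. norm (t m)) summable_on UNIV"
    unfolding t_def by (rule theta_abs_summable[OF w])
  have "(\<lambda>N. \<Sum>\<^sub>\<infinity>m. f N m) \<longlonglongrightarrow> (\<Sum>\<^sub>\<infinity>m. t m / qpoch_inf q q)"
  proof (rule infsum_dominated_convergence)
    show "(\<lambda>m. C * (D * D) * norm (t m)) summable_on UNIV"
      by (rule summable_on_cmult_right[OF t])
    show "norm (f N m) \<le> C * (D * D) * norm (t m)" for N m
    proof (cases "m \<in> {-int N..int N}")
      case True
      have "norm (f N m) = norm (qpoch q q (2 * N)) * (norm (inverse (qpoch q q (nat (int N + m)))) *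
          norm (inverse (qpoch q q (nat (int N - m))))) * norm (t m)"
        using True by (simp add: f_def norm_mult norm_divide norm_inverse divide_inverse)
      also have "\<dots> \<le> C * (D * D) * norm (t m)"
        using C D by (intro mult_mono mult_nonneg_nonneg) auto
      finally show ?thesis .
    qed (use C D in \<open>auto simp: f_def\<close>)
    show "(\<lambda>N. f N m) \<longlonglongrightarrow> t m / qpoch_inf q q" for m
    proof (rule Lim_transform_eventually)
      have lim: "filterlim (\<lambda>N. 2 * N) at_top sequentially"
        "filterlim (\<lambda>N. nat (int N + m)) at_top sequentially"
        "filterlim (\<lambda>N. nat (int N - m)) at_top sequentially"
        by real_asymp+
      have "(\<lambda>N. qpoch q q (2 * N) / (qpoch q q (nat (int N + m)) * qpoch q q (nat (int N - m))) * t m)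
          \<longlonglongrightarrow> qpoch_inf q q / (qpoch_inf q q * qpoch_inf q q) * t m"
        using nz by (intro tendsto_mult tendsto_divide tendsto_const
           filterlim_compose[OF qpoch_tendsto[OF q1]] lim) auto
      then show "(\<lambda>N. qpoch q q (2 * N) / (qpoch q q (nat (int N + m)) * qpoch q q (nat (int N - m))) * t m)
          \<longlonglongrightarrow> t m / qpoch_inf q q"
        using nz by simp
      show "\<forall>\<^sub>F N in sequentially. qpoch q q (2 * N) /
          (qpoch q q (nat (int N + m)) * qpoch q q (nat (int N - m))) * t m = f N m"
        using eventually_ge_at_top[of "nat \<bar>m\<bar>"] by eventually_elim (auto simp: f_def)
    qed
  qed
  moreover have "(\<Sum>\<^sub>\<infinity>m. f N m) = qpoch (- w) q N * qpoch (- q / w) q N" for N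
  proof -
    have "(\<Sum>\<^sub>\<infinity>m. f N m) = (\<Sum>\<^sub>\<infinity>m\<in>{-int N..int N}. f N m)"
      by (rule infsum_cong_neutral) (auto simp: f_def)
    also have "\<dots> = qpoch (- w) q N * qpoch (- q / w) q N"
      unfolding finite_jacobi_triple_product[OF w] by (simp add: f_def t_def)
    finally show ?thesis .
  qed
  moreover have "(\<lambda>N. qpoch (- w) q N * qpoch (- q / w) q N) \<longlonglongrightarrow> qpoch_inf (- w) q * qpoch_inf (- q / w) q"
    by (intro tendsto_mult qpoch_tendsto q1)
  ultimately have "(\<Sum>\<^sub>\<infinity>m. t m / qpoch_inf q q) = qpoch_inf (- w) q * qpoch_inf (- q / w) q"
    using LIMSEQ_unique by force
  then have "(\<Sum>\<^sub>\<infinity>m. t m) = qpoch_inf (- w) q * qpoch_inf (- q / w) q * qpoch_inf q q"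
    using nz unfolding divide_inverse infsum_cmult_left' by (simp add: divide_inverse[symmetric] nonzero_divide_eq_eq)
  moreover have "t summable_on UNIV"
    by (rule abs_summable_summable[OF t])
  ultimately show ?thesis
    unfolding t_def by (simp add: has_sum_iff)
qed

text \<open>Theta at its zero -q^n: the reflection m -> 1 - 2n - m preserves the exponent and
  reverses the sign, since 1 - 2n is odd.\<close>

lemma theta_vanishes:
  "((\<lambda>m. (- 1) powi m * q powi (tri m + n * m)) has_sum 0) UNIV"
proof -
  define f where "f m = (- 1) powi m * q powi (tri m + n * m)" for m
  have "f m = (- 1 * q powi n) powi m * q powi tri m" for m
    unfolding f_def power_int_mult_distrib q_powi_add power_int_mult by (simp only: mult_ac)
  then have "f = (\<lambda>m. (- 1 * q powi n) powi m * q powi tri m)"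
    by blast
  then have "f summable_on UNIV"
    using abs_summable_summable[OF theta_abs_summable[of "- 1 * q powi n"]] q0 by simp
  then have 1: "(f has_sum infsum f UNIV) UNIV" by simp
  have eq: "f (1 - 2 * n - m) = - f m" for m
  proof -
    have "2 * (tri (1 - 2 * n - m) + n * (1 - 2 * n - m)) = 2 * (tri m + n * m)"
      unfolding distrib_left tri_double by (simp add: algebra_simps)
    then have "tri (1 - 2 * n - m) + n * (1 - 2 * n - m) = tri m + n * m" by simp
    moreover have "(- 1 :: complex) powi (1 - 2 * n - m) = - ((- 1) powi m)"
      by (cases "even m") auto
    ultimately show ?thesis by (simp only: f_def mult_minus_left)
  qed
  have "((\<lambda>m. f (1 - 2 * n - m)) has_sum infsum f UNIV) UNIV"
    using 1 by (subst has_sum_reindex_bij_witness[of _ "\<lambda>m. 1 - 2 * n - m" "\<lambda>m. 1 - 2 * n - m" _ f]) auto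
  then have "((\<lambda>m. - f m) has_sum infsum f UNIV) UNIV"
    by (simp only: eq)
  moreover have "((\<lambda>m. - f m) has_sum - infsum f UNIV) UNIV"
    using 1 by (simp add: has_sum_uminus)
  ultimately have "infsum f UNIV = - infsum f UNIV"
    by (rule has_sum_unique)
  with 1 show ?thesis
    by (simp add: f_def[abs_def])
qed

end

subsection \<open>A summable conjugate Bailey pair\<close>

text \<open>The series U satisfies U(y p) = (1 - y) U(y). Iterating from x and letting p^n tend to 0
  gives (x;p)_inf U(x) = U(0) = 1.\<close>

lemma euler_q_exponential:
  fixes p x :: complex
  assumes p: "norm p < 1" and x: "norm x < 1"
  shows "(\<lambda>m. x ^ m / qpoch p p m) sums (1 / qpoch_inf x p)"
proof -
  define U where "U y = (\<Sum>m. y ^ m / qpoch p p m)" for y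
  note nz = qpoch_nonzero[OF p p]
  obtain D where D: "D > 0" "\<And>n. norm (inverse (qpoch p p n)) \<le> D"
    using inverse_qpoch_bounded[OF p p] by blast
  have bound: "norm (y ^ m / qpoch p p m) \<le> D * norm x ^ m" if "norm y \<le> norm x" for y m
  proof -
    have "norm (y ^ m / qpoch p p m) = norm (inverse (qpoch p p m)) * norm y ^ m"
      by (simp add: norm_divide norm_power norm_inverse) (simp add: divide_inverse)
    also have "\<dots> \<le> D * norm x ^ m"
      using D that by (intro mult_mono power_mono) auto
    finally show ?thesis .
  qed
  have geom: "summable (\<lambda>m. D * norm x ^ m)"
    using x by (intro summable_mult summable_geometric) simp
  have smry: "summable (\<lambda>m. y ^ m / qpoch p p m)" if "norm y \<le> norm x" for y
    by (rule summable_comparison_test'[OF geom, of 0]) (rule bound[OF that])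
  have step: "U (y * p) = (1 - y) * U y" if y: "norm y \<le> norm x" for y
  proof -
    have "norm y * norm p \<le> norm x * 1"
      using p y by (intro mult_mono) auto
    then have yp: "norm (y * p) \<le> norm x"
      by (simp add: norm_mult)
    have "(\<lambda>m. y ^ m / qpoch p p m - (y * p) ^ m / qpoch p p m) sums (U y - U (y * p))"
      unfolding U_def by (intro sums_diff summable_sums smry y yp)
    moreover have "(\<lambda>m. y ^ Suc m / qpoch p p (Suc m) - (y * p) ^ Suc m / qpoch p p (Suc m)) = (\<lambda>m. y * (y ^ m / qpoch p p m))"
    proof
      fix m
      have "1 - p * p ^ m \<noteq> 0" by (rule qpoch_factor_nonzero[OF p p])
      moreover have "y ^ Suc m / qpoch p p (Suc m) - (y * p) ^ Suc m / qpoch p p (Suc m)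
          = y * y ^ m * (1 - p * p ^ m) / (qpoch p p m * (1 - p * p ^ m))"
        by (simp add: qpoch_Suc power_mult_distrib diff_divide_distrib[symmetric] algebra_simps)
      ultimately show "y ^ Suc m / qpoch p p (Suc m) - (y * p) ^ Suc m / qpoch p p (Suc m) = y * (y ^ m / qpoch p p m)"
        by simp
    qed
    ultimately have "(\<lambda>m. y * (y ^ m / qpoch p p m)) sums (U y - U (y * p))"
      using sums_Suc_iff[of "\<lambda>m. y ^ m / qpoch p p m - (y * p) ^ m / qpoch p p m"] by simp
    moreover have "(\<lambda>m. y * (y ^ m / qpoch p p m)) sums (y * U y)"
      unfolding U_def by (intro sums_mult summable_sums smry y)
    ultimately have "U y - U (y * p) = y * U y" by (rule sums_unique2)
    then show ?thesis by (simp add: algebra_simps)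
  qed
  have le: "norm (x * p ^ n) \<le> norm x" for n
    using p by (simp add: norm_mult norm_power mult_left_le power_le_one)
  have iter: "U (x * p ^ n) = qpoch x p n * U x" for n
  proof (induction n)
    case (Suc n)
    then show ?case
      using step[OF le[of n]] by (simp add: qpoch_Suc ac_simps)
  qed simp
  have "(\<lambda>n. \<Sum>m. (x * p ^ n) ^ m / qpoch p p m) \<longlonglongrightarrow> (\<Sum>m. 0 ^ m / qpoch p p m)"
  proof (rule tannerys_theorem[THEN conjunct2, THEN conjunct2])
    show "(\<lambda>n. (x * p ^ n) ^ m / qpoch p p m) \<longlonglongrightarrow> 0 ^ m / qpoch p p m" for m
      using p nz by (intro tendsto_divide tendsto_const tendsto_power tendsto_mult_right_zero LIMSEQ_power_zero) auto
    show "\<forall>\<^sub>F (m, n) in sequentially \<times>\<^sub>F sequentially. norm ((x * p ^ n) ^ m / qpoch p p m) \<le> D * norm x ^ m"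
      by (rule always_eventually) (use bound[OF le] in auto)
  qed (use geom in auto)
  moreover have "(\<Sum>m. 0 ^ m / qpoch p p m) = 1"
    using powser_zero[of "\<lambda>m. 1 / qpoch p p m"] by simp
  ultimately have "(\<lambda>n. U (x * p ^ n)) \<longlonglongrightarrow> 1"
    by (simp add: U_def)
  then have "(\<lambda>n. qpoch x p n * U x) \<longlonglongrightarrow> 1"
    by (simp add: iter)
  moreover have "(\<lambda>n. qpoch x p n * U x) \<longlonglongrightarrow> qpoch_inf x p * U x"
    by (intro tendsto_mult qpoch_tendsto p tendsto_const)
  ultimately have "qpoch_inf x p * U x = 1"
    using LIMSEQ_unique by blast
  then have "U x = 1 / qpoch_inf x p"
    using qpoch_inf_nonzero[OF p x] by (simp add: field_simps)
  then show ?thesis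
    using summable_sums[OF smry[of x]] by (simp add: U_def)
qed

context
  fixes q :: complex
  assumes q0: "q \<noteq> 0" and q1: "norm q < 1"
begin

lemma norm_q_square: "norm (q ^ 2) < 1"
  using q1 by (simp add: norm_power power_less_one_iff)

text \<open>The right-hand side is a difference in \<open>m\<close> (a Wilf-Zeilberger certificate), so summing over \<open>m\<close>
  shows that \<open>1 + q\<^bsup>2k+1\<^esup>\<close> times the sum is independent of \<open>k\<close>.\<close>

lemma conjugate_bailey_step:
  "(1 + q ^ (2 * k + 1)) * (q ^ Suc m * qpoch (- q) q (2 * (Suc m + k)) / (qpoch (q^2) (q^2) (Suc m) * qpoch (q^2) (q^2) (Suc m + 2 * k + 1)))
   - (1 + q ^ (2 * k + 3)) * (q ^ m * qpoch (- q) q (2 * (m + Suc k)) / (qpoch (q^2) (q^2) m * qpoch (q^2) (q^2) (m + 2 * Suc k + 1)))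
   = (1 - q ^ (2 * k + 2)) * (q ^ Suc m * qpoch (- q) q (2 * (Suc m + k + 1)) / (qpoch (q^2) (q^2) (Suc m) * qpoch (q^2) (q^2) (Suc m + 2 * k + 2)))
   - (1 - q ^ (2 * k + 2)) * (q ^ m * qpoch (- q) q (2 * (m + k + 1)) / (qpoch (q^2) (q^2) m * qpoch (q^2) (q^2) (m + 2 * k + 2)))"
proof -
  define K M where "K = q ^ k" and "M = q ^ m"
  define B where "B = qpoch (- q) q (2 * (m + k + 1))"
  define P where "P = qpoch (q^2) (q^2) m"
  define R where "R = qpoch (q^2) (q^2) (m + 2 * k + 2)"
  define a where "a = 1 - q^2 * M^2"
  define b where "b = 1 - q^6 * M^2 * K^4"
  note nz = qpoch_nonzero[OF norm_q_square norm_q_square]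
  note nz' = qpoch_factor_nonzero[OF norm_q_square norm_q_square]
  have a: "1 - q^2 * (q^2) ^ m = a" unfolding a_def M_def by (simp flip: power_mult add: mult.commute)
  have b: "1 - q^2 * (q^2) ^ (m + 2 * k + 2) = b"
  proof -
    have "q^2 * (q^2) ^ (m + 2 * k + 2) = q ^ (2 + 2 * (m + 2 * k + 2))"
      by (simp only: power_mult power_add)
    also have "\<dots> = q ^ (6 + m * 2 + k * 4)"
      by (rule arg_cong[of _ _ "(^) q"]) simp
    also have "\<dots> = q^6 * M^2 * K^4"
      by (simp only: power_mult power_add M_def K_def)
    finally show ?thesis by (simp only: b_def)
  qed
  have "P \<noteq> 0" "R \<noteq> 0" using nz by (auto simp: P_def R_def)
  moreover have "a \<noteq> 0" "b \<noteq> 0" using nz' a b by metis+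
  moreover have "qpoch (q^2) (q^2) (Suc m) = P * a" by (simp add: P_def qpoch_Suc a)
  moreover have "qpoch (q^2) (q^2) (Suc m + 2 * k + 2) = R * b"
    using b by (simp add: R_def qpoch_Suc)
  moreover have "qpoch (q^2) (q^2) (Suc m + 2 * k + 1) = R" "qpoch (q^2) (q^2) (m + 2 * Suc k + 1) = R * b"
    using b by (simp_all add: R_def qpoch_Suc)
  moreover have "qpoch (- q) q (2 * (Suc m + k)) = B" "qpoch (- q) q (2 * (m + Suc k)) = B"
    by (simp_all add: B_def)
  moreover have "qpoch (- q) q (2 * (Suc m + k + 1)) = B * ((1 + q^3 * M^2 * K^2) * (1 + q^4 * M^2 * K^2))"
  proof -
    have "2 * (Suc m + k + 1) = Suc (Suc (2 * (m + k + 1)))" by simp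
    then have "qpoch (- q) q (2 * (Suc m + k + 1)) = B * ((1 + q * q ^ (2 * (m + k + 1))) * (1 + q * q ^ Suc (2 * (m + k + 1))))"
      by (simp only: qpoch_Suc B_def mult_minus_left diff_minus_eq_add mult.assoc)
    moreover have "q * q ^ (2 * (m + k + 1)) = q^3 * M^2 * K^2" "q * q ^ Suc (2 * (m + k + 1)) = q^4 * M^2 * K^2"
      by (simp_all add: M_def K_def power_add power_mult power2_eq_square power_mult_distrib eval_nat_numeral ac_simps)
    ultimately show ?thesis by simp
  qed
  moreover have "q ^ (2 * k + 1) = q * K^2" "q ^ (2 * k + 2) = q^2 * K^2" "q ^ (2 * k + 3) = q^3 * K^2"
    unfolding K_def power_add power_even_eq power_one_right by (rule mult.commute)+
  moreover have "q ^ Suc m = q * M" "q ^ m = M" by (simp_all add: M_def)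
  \<comment> \<open>The certificate as a polynomial identity in q, M, K, with the common factor
    \<open>M * B / (P * a * (R * b))\<close> removed.\<close>
  moreover have "(1 + q * K^2) * q * b - (1 + q^3 * K^2) * a
      = (1 - q^2 * K^2) * (q * ((1 + q^3 * M^2 * K^2) * (1 + q^4 * M^2 * K^2)) - a * b)"
    unfolding a_def b_def by algebra
  moreover have "(1 + q * K^2) * (q * M * B / (P * a * R)) - (1 + q^3 * K^2) * (M * B / (P * (R * b)))
      = ((1 + q * K^2) * q * b - (1 + q^3 * K^2) * a) * (M * B / (P * a * (R * b)))"
    using calculation(1-4) by (simp add: divide_simps) (simp add: algebra_simps)
  moreover have "(1 - q^2 * K^2) * (q * M * (B * ((1 + q^3 * M^2 * K^2) * (1 + q^4 * M^2 * K^2))) / (P * a * (R * b)))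
      - (1 - q^2 * K^2) * (M * B / (P * R))
    = (1 - q^2 * K^2) * (q * ((1 + q^3 * M^2 * K^2) * (1 + q^4 * M^2 * K^2)) - a * b) * (M * B / (P * a * (R * b)))"
    using calculation(1-4) by (simp add: divide_simps) (simp add: algebra_simps)
  ultimately show ?thesis
    unfolding P_def[symmetric] R_def[symmetric] B_def[symmetric] by (simp only:)
qed

text \<open>What the k-th partial fraction contributes to the term n = m + k of F4, apart from a
  factor depending only on k.\<close>

definition conj_bailey_term :: "nat \<Rightarrow> nat \<Rightarrow> complex" where
  "conj_bailey_term k m = q ^ m * qpoch (- q) q (2 * (m + k)) /
     (qpoch (q^2) (q^2) m * qpoch (q^2) (q^2) (m + 2 * k + 1))"

text \<open>The last estimate leaves the \<open>qpoch\<close> indices free, so that it also covers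
  the telescoping certificate.\<close>

lemma conj_bailey_term_bound:
  obtains C where "C > 0" "\<And>k m. norm (conj_bailey_term k m) \<le> C * norm q ^ m"
    "\<And>k m n. norm (q ^ m * qpoch (- q) q n / (qpoch (q^2) (q^2) m * qpoch (q^2) (q^2) k)) \<le> C * norm q ^ m"
proof -
  obtain C where C: "C > 0" "\<And>n. norm (qpoch (- q) q n) \<le> C"
    using qpoch_bounded[OF q1] by blast
  obtain D where D: "D > 0" "\<And>n. norm (inverse (qpoch (q^2) (q^2) n)) \<le> D"
    using inverse_qpoch_bounded[OF norm_q_square norm_q_square] by blast
  have *: "norm (q ^ m * qpoch (- q) q n / (qpoch (q^2) (q^2) m * qpoch (q^2) (q^2) k)) \<le> (C * (D * D)) * norm q ^ m" for k m n
  proof -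
    have "norm (q ^ m * qpoch (- q) q n / (qpoch (q^2) (q^2) m * qpoch (q^2) (q^2) k)) =
      (norm (qpoch (- q) q n) * (norm (inverse (qpoch (q^2) (q^2) m)) * norm (inverse (qpoch (q^2) (q^2) k)))) * norm q ^ m"
      by (simp add: norm_mult norm_divide norm_power norm_inverse) (simp add: divide_inverse)
    also have "\<dots> \<le> (C * (D * D)) * norm q ^ m"
      using C D by (intro mult_mono mult_nonneg_nonneg) auto
    finally show ?thesis .
  qed
  show thesis
    by (rule that[of "C * (D * D)"]) (use C D * in \<open>auto simp: conj_bailey_term_def\<close>)
qed

lemma conj_bailey_term_summable: "summable (conj_bailey_term k)"
proof -
  obtain C where C: "\<And>k m. norm (conj_bailey_term k m) \<le> C * norm q ^ m"
    using conj_bailey_term_bound by metis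
  have "summable (\<lambda>m. C * norm q ^ m)"
    using q1 by (intro summable_mult summable_geometric) simp
  then show ?thesis
    by (rule summable_comparison_test'[of _ 0]) (rule C)
qed

text \<open>Equals (-q;q)_inf / (q;q)_inf, because (q;q^2)_inf (q^2;q^2)_inf = (q;q)_inf.\<close>

definition conj_bailey_const :: complex where
  "conj_bailey_const = qpoch_inf (- q) q / (qpoch_inf (q^2) (q^2) * qpoch_inf q (q^2))"

text \<open>The value of a summable case of the \<open>q\<close>-Gauss sum in base \<open>q\<^sup>2\<close>.\<close>

lemma conj_bailey_term_sums:
  "conj_bailey_term k sums (conj_bailey_const / (1 + q ^ (2 * k + 1)))"
proof -
  \<comment> \<open>Normalised to be independent of k, so that its value can be read off as k tends
    to infinity.\<close>
  define S where "S k = (1 + q ^ (2 * k + 1)) * (\<Sum>m. conj_bailey_term k m)" for k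
  note nz = qpoch_nonzero[OF norm_q_square norm_q_square]
  obtain C where C: "C > 0" "\<And>k m. norm (conj_bailey_term k m) \<le> C * norm q ^ m"
    "\<And>k m n. norm (q ^ m * qpoch (- q) q n / (qpoch (q^2) (q^2) m * qpoch (q^2) (q^2) k)) \<le> C * norm q ^ m"
    using conj_bailey_term_bound by metis
  have q_plus: "1 + q ^ (2 * k + 1) \<noteq> 0" for k
    using qpoch_factor_nonzero[of q "- q" "2 * k"] q1 by simp
  have "S k = S (Suc k)" for k
  proof -
    define c where "c m = (1 - q ^ (2 * k + 2)) * (q ^ m * qpoch (- q) q (2 * (m + k + 1)) /
       (qpoch (q^2) (q^2) m * qpoch (q^2) (q^2) (m + 2 * k + 2)))" for m
    have step: "(1 + q ^ (2 * k + 1)) * conj_bailey_term k (Suc m) =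
        (1 + q ^ (2 * k + 3)) * conj_bailey_term (Suc k) m + (c (Suc m) - c m)" for m
      using conjugate_bailey_step[of k m] unfolding conj_bailey_term_def c_def
      by (simp only: diff_eq_eq add.commute[of "_ - _"])
    \<comment> \<open>The \<open>m = 0\<close> term, absent from the shifted sum, cancels the
      boundary term of the telescoping sum.\<close>
    have 0: "(1 + q ^ (2 * k + 1)) * conj_bailey_term k 0 = c 0"
    proof -
      have "q * q ^ (2 * k) = q ^ (2 * k + 1)" "q * q ^ Suc (2 * k) = q ^ (2 * k + 2)"
        by simp_all
      then have "qpoch (- q) q (2 * (0 + k + 1)) = qpoch (- q) q (2 * k) * (1 + q ^ (2 * k + 1)) * (1 + q ^ (2 * k + 2))"
        by (simp add: qpoch_Suc)
      moreover have "q^2 * (q^2) ^ (2 * k + 1) = (q ^ (2 * k + 2)) ^ 2"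
        by (simp add: power_even_eq power2_eq_square power_mult_distrib ac_simps)
      then have "qpoch (q^2) (q^2) (0 + 2 * k + 2) = qpoch (q^2) (q^2) (2 * k + 1) * ((1 - q ^ (2 * k + 2)) * (1 + q ^ (2 * k + 2)))"
        by (simp add: qpoch_Suc power2_eq_square algebra_simps)
      moreover have "(1 - q ^ (2 * k + 2)) * (1 + q ^ (2 * k + 2)) \<noteq> 0"
        using nz[of "2 * k + 2"] calculation(2) by auto
      ultimately show ?thesis
        by (simp add: conj_bailey_term_def c_def)
    qed
    have "c \<longlonglongrightarrow> 0"
    proof (rule Lim_null_comparison)
      show "\<forall>\<^sub>F m in sequentially. norm (c m) \<le> norm (1 - q ^ (2 * k + 2)) * (C * norm q ^ m)"
        unfolding c_def norm_mult[of "1 - _"]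
        by (intro always_eventually allI mult_left_mono C(3) norm_ge_zero)
      show "(\<lambda>m. norm (1 - q ^ (2 * k + 2)) * (C * norm q ^ m)) \<longlonglongrightarrow> 0"
        using q1 by (intro tendsto_mult_right_zero LIMSEQ_power_zero) auto
    qed
    then have "(\<lambda>m. c (Suc m) - c m) sums (0 - c 0)"
      by (rule telescope_sums)
    then have "(\<lambda>m. (1 + q ^ (2 * k + 3)) * conj_bailey_term (Suc k) m + (c (Suc m) - c m))
        sums ((1 + q ^ (2 * k + 3)) * (\<Sum>m. conj_bailey_term (Suc k) m) + (0 - c 0))"
      by (intro sums_add sums_mult summable_sums conj_bailey_term_summable)
    then have "(\<lambda>m. (1 + q ^ (2 * k + 1)) * conj_bailey_term k (Suc m)) sums (S (Suc k) - c 0)"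
      unfolding step by (simp add: S_def numeral_3_eq_3)
    then have "(\<lambda>m. (1 + q ^ (2 * k + 1)) * conj_bailey_term k m) sums (S (Suc k))"
      using sums_Suc_iff[of "\<lambda>m. (1 + q ^ (2 * k + 1)) * conj_bailey_term k m" "S (Suc k) - c 0"]
      by (simp add: 0[simplified])
    moreover have "(\<lambda>m. (1 + q ^ (2 * k + 1)) * conj_bailey_term k m) sums (S k)"
      unfolding S_def by (intro sums_mult summable_sums conj_bailey_term_summable)
    ultimately show ?thesis
      using sums_unique2 by blast
  qed
  then have S_const: "S k = S 0" for k
    by (induction k) auto
  \<comment> \<open>In the limit the factors involving k reach infinite products, and Euler's series
    at x = q in base q^2 remains.\<close>
  have "S \<longlonglongrightarrow> (1 + 0) * (\<Sum>m. q ^ m * qpoch_inf (- q) q / (qpoch (q^2) (q^2) m * qpoch_inf (q^2) (q^2)))"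
    unfolding S_def
  proof (intro tendsto_mult tendsto_add tendsto_const)
    show "(\<lambda>k. q ^ (2 * k + 1)) \<longlonglongrightarrow> 0"
      using LIMSEQ_power_zero[OF q1] by (rule filterlim_compose) real_asymp
    show "(\<lambda>k. \<Sum>m. conj_bailey_term k m) \<longlonglongrightarrow>
        (\<Sum>m. q ^ m * qpoch_inf (- q) q / (qpoch (q^2) (q^2) m * qpoch_inf (q^2) (q^2)))"
    proof (rule tannerys_theorem[THEN conjunct2, THEN conjunct2])
      show "(\<lambda>k. conj_bailey_term k m) \<longlonglongrightarrow>
          q ^ m * qpoch_inf (- q) q / (qpoch (q^2) (q^2) m * qpoch_inf (q^2) (q^2))" for m
      proof -
        have "filterlim (\<lambda>k. 2 * (m + k)) at_top sequentially"
          "filterlim (\<lambda>k. m + 2 * k + 1) at_top sequentially"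
          by real_asymp+
        then show ?thesis
          unfolding conj_bailey_term_def
          using nz qpoch_inf_nonzero[OF norm_q_square norm_q_square]
          by (intro tendsto_divide tendsto_mult tendsto_const filterlim_compose[OF qpoch_tendsto[OF q1]]
              filterlim_compose[OF qpoch_tendsto[OF norm_q_square]]) auto
      qed
      show "\<forall>\<^sub>F (m, k) in sequentially \<times>\<^sub>F sequentially. norm (conj_bailey_term k m) \<le> C * norm q ^ m"
        by (rule always_eventually) (use C(2) in auto)
      show "summable (\<lambda>m. C * norm q ^ m)"
        using q1 by (intro summable_mult summable_geometric) simp
    qed simp
  qed
  moreover have "(\<lambda>m. (q ^ m / qpoch (q^2) (q^2) m) * (qpoch_inf (- q) q / qpoch_inf (q^2) (q^2)))
      sums ((1 / qpoch_inf q (q^2)) * (qpoch_inf (- q) q / qpoch_inf (q^2) (q^2)))"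
    by (intro sums_mult2 euler_q_exponential norm_q_square q1)
  then have "(\<Sum>m. q ^ m * qpoch_inf (- q) q / (qpoch (q^2) (q^2) m * qpoch_inf (q^2) (q^2))) = conj_bailey_const"
    by (simp add: sums_iff conj_bailey_const_def mult.commute)
  ultimately have "S \<longlonglongrightarrow> conj_bailey_const"
    by simp
  moreover have "S = (\<lambda>_. S 0)"
    using S_const by blast
  ultimately have "S 0 = conj_bailey_const"
    by (metis LIMSEQ_unique tendsto_const)
  then have "(1 + q ^ (2 * k + 1)) * (\<Sum>m. conj_bailey_term k m) = conj_bailey_const"
    using S_const[of k] by (simp add: S_def)
  then have "(\<Sum>m. conj_bailey_term k m) = conj_bailey_const / (1 + q ^ (2 * k + 1))"
    using q_plus[of k] by (simp add: nonzero_eq_divide_eq mult.commute)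
  then show ?thesis
    using conj_bailey_term_summable[of k] by (simp add: sums_iff)
qed

lemma qpoch_double: "qpoch q (q^2) n * qpoch (q^2) (q^2) n = qpoch q q (2 * n)"
proof (induction n)
  case (Suc n)
  have "qpoch q q (2 * Suc n) = qpoch q q (2 * n) * (1 - q * q ^ (2 * n)) * (1 - q^2 * q ^ (2 * n))"
    by (simp add: qpoch_Suc power2_eq_square mult.assoc)
  moreover have "qpoch q (q^2) (Suc n) * qpoch (q^2) (q^2) (Suc n)
      = (qpoch q (q^2) n * qpoch (q^2) (q^2) n) * (1 - q * q ^ (2 * n)) * (1 - q^2 * q ^ (2 * n))"
    unfolding qpoch_Suc power_mult by (simp only: mult_ac)
  ultimately show ?case by (simp only: Suc.IH)
qed simp

lemma qpoch_minus: "qpoch q q n * qpoch (- q) q n = qpoch (q^2) (q^2) n"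
proof (induction n)
  case (Suc n)
  have "(1 - q * q ^ n) * (1 + q * q ^ n) = 1 - q^2 * (q^2) ^ n"
    by (simp add: power2_eq_square power_mult_distrib algebra_simps)
  then show ?case
    by (simp add: qpoch_Suc Suc.IH[symmetric] algebra_simps)
qed simp

text \<open>The triple product in base q^2 at w = -q gives (q;q^2)_inf (q;q^2)_inf (q^2;q^2)_inf;
  Euler's identity (q;q^2)_inf (-q;q)_inf = 1 turns this into the reciprocal constant.\<close>

lemma gauss_theta:
  "((\<lambda>n. (- 1) powi n * q powi (n ^ 2)) has_sum (1 / conj_bailey_const)) UNIV"
  and conj_bailey_const_nonzero: "conj_bailey_const \<noteq> 0"
proof -
  note p1 = norm_q_square
  have nz: "qpoch_inf (q^2) (q^2) \<noteq> 0" "qpoch_inf q (q^2) \<noteq> 0" "qpoch_inf (- q) q \<noteq> 0" "qpoch_inf q q \<noteq> 0"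
    using qpoch_inf_nonzero[OF p1 p1] qpoch_inf_nonzero[OF p1 q1] qpoch_inf_nonzero[OF q1 q1]
      qpoch_inf_nonzero[OF q1, of "- q"] q1 by auto
  then show "conj_bailey_const \<noteq> 0" by (simp add: conj_bailey_const_def)
  have "(\<lambda>n. qpoch q q (2 * n)) \<longlonglongrightarrow> qpoch_inf q q"
    by (rule filterlim_compose[OF qpoch_tendsto[OF q1]]) real_asymp
  moreover have "(\<lambda>n. qpoch q (q^2) n * qpoch (q^2) (q^2) n) \<longlonglongrightarrow> qpoch_inf q (q^2) * qpoch_inf (q^2) (q^2)"
    by (intro tendsto_mult qpoch_tendsto p1)
  ultimately have 1: "qpoch_inf q (q^2) * qpoch_inf (q^2) (q^2) = qpoch_inf q q"
    unfolding qpoch_double by (rule LIMSEQ_unique[rotated])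
  have "(\<lambda>n. qpoch q q n * qpoch (- q) q n) \<longlonglongrightarrow> qpoch_inf q q * qpoch_inf (- q) q"
    by (intro tendsto_mult qpoch_tendsto q1)
  moreover have "qpoch (q^2) (q^2) \<longlonglongrightarrow> qpoch_inf (q^2) (q^2)"
    by (rule qpoch_tendsto[OF p1])
  ultimately have 2: "qpoch_inf q q * qpoch_inf (- q) q = qpoch_inf (q^2) (q^2)"
    unfolding qpoch_minus using LIMSEQ_unique by blast
  have "((\<lambda>m. (- q) powi m * (q^2) powi tri m) has_sum
     qpoch_inf q (q^2) * qpoch_inf q (q^2) * qpoch_inf (q^2) (q^2)) UNIV"
    using jacobi_triple_product[of "q^2" "- q"] q0 p1 by (simp add: power2_eq_square)
  also have "(\<lambda>m. (- q) powi m * (q^2) powi tri m) = (\<lambda>m. (- 1) powi m * q powi (m ^ 2))"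
  proof
    fix m
    have "(q^2) powi tri m = q powi (2 * tri m)"
      by (simp add: power_int_power)
    moreover have "(- q) powi m = (- 1) powi m * q powi m"
      using power_int_mult_distrib[of "-1" q m] by simp
    ultimately show "(- q) powi m * (q^2) powi tri m = (- 1) powi m * q powi (m ^ 2)"
      unfolding tri_square q_powi_add[OF q0 q1] by (simp only: mult_ac)
  qed
  also have "qpoch_inf q (q^2) * qpoch_inf q (q^2) * qpoch_inf (q^2) (q^2) = 1 / conj_bailey_const"
  proof -
    have "qpoch_inf q (q^2) * qpoch_inf (- q) q * qpoch_inf (q^2) (q^2) = qpoch_inf (q^2) (q^2)"
      using 1 2 by (metis mult.assoc mult.commute)
    then have "qpoch_inf q (q^2) * qpoch_inf (- q) q = 1" using nz by simp
    then have "qpoch_inf q (q^2) = 1 / qpoch_inf (- q) q" using nz by (simp add: eq_divide_eq)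
    then show ?thesis by (simp add: conj_bailey_const_def)
  qed
  finally show "((\<lambda>n. (- 1) powi n * q powi (n ^ 2)) has_sum (1 / conj_bailey_const)) UNIV" .
qed

end

subsection \<open>Laurent coefficients of the Lerch quotients\<close>

lemma summable_on_product_real:
  fixes f :: "'a \<Rightarrow> real" and g :: "'b \<Rightarrow> real"
  assumes "f summable_on A" "g summable_on B" "\<And>x. x \<in> A \<Longrightarrow> f x \<ge> 0" "\<And>y. y \<in> B \<Longrightarrow> g y \<ge> 0"
  shows "(\<lambda>(x, y). f x * g y) summable_on A \<times> B"
proof (rule summable_on_SigmaI)
  fix x assume "x \<in> A"
  show "((\<lambda>y. case (x, y) of (x, y) \<Rightarrow> f x * g y) has_sum f x * infsum g B) B"
    using assms(2) by (simp add: has_sum_cmult_right)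
next
  show "(\<lambda>x. f x * infsum g B) summable_on A"
    using assms(1) by (rule summable_on_cmult_left)
qed (use assms in auto)

lemma has_sum_odd:
  fixes f :: "int \<Rightarrow> complex"
  assumes "f summable_on UNIV" "\<And>n. f (- n) = - f n"
  shows "(f has_sum 0) UNIV"
proof -
  have 1: "(f has_sum infsum f UNIV) UNIV" using assms(1) by simp
  then have "((\<lambda>n. f (- n)) has_sum infsum f UNIV) UNIV"
    by (subst has_sum_reindex_bij_witness[of _ uminus uminus _ f]) auto
  then have "((\<lambda>n. - f n) has_sum infsum f UNIV) UNIV"
    by (simp only: assms(2))
  moreover have "((\<lambda>n. - f n) has_sum - infsum f UNIV) UNIV"
    using 1 by (simp add: has_sum_uminus)
  ultimately have "infsum f UNIV = - infsum f UNIV"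
    by (rule has_sum_unique)
  with 1 show ?thesis by simp
qed

context
  fixes q :: complex
  assumes q0: "q \<noteq> 0" and q1: "norm q < 1"
begin

text \<open>Multiplying theta by the geometric series of 1/(1 + z q^(2k+1)) gives z^n the terms
  (-1)^r q^((2k+1) r + tri(n - r)) for r >= 0; here the exponent is expanded. Allowing negative r
  makes the bilateral sum available.\<close>

definition lerch_term :: "nat \<Rightarrow> int \<Rightarrow> int \<Rightarrow> complex" where
  "lerch_term k n r = q powi tri n * ((- 1) powi r * q powi (tri r + (2 * int k + 2 - n) * r))"

definition lerch_coeff :: "nat \<Rightarrow> int \<Rightarrow> complex" where
  "lerch_coeff k n = infsum (lerch_term k n) {0..}"

text \<open>This is the zero of theta at the pole z = -q^(-(2k+1)).\<close>

lemma lerch_term_has_sum_0: "(lerch_term k n has_sum 0) UNIV"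
  using has_sum_cmult_right[OF theta_vanishes[OF q0 q1, of "2 * int k + 2 - n"], of "q powi tri n"]
  by (simp add: lerch_term_def[abs_def])

lemma lerch_term_summable: "lerch_term k n summable_on A"
  using lerch_term_has_sum_0 by (meson has_sum_imp_summable subset_UNIV summable_on_subset)

lemma lerch_term_shift: "q ^ (2 * k + 1) * lerch_term k (n - 1) r = - lerch_term k n (r + 1)"
proof -
  have "2 * (int (2 * k + 1) + (tri (n - 1) + (tri r + (2 * int k + 2 - (n - 1)) * r)))
      = 2 * (tri n + (tri (r + 1) + (2 * int k + 2 - n) * (r + 1)))"
    unfolding distrib_left tri_double by (simp add: algebra_simps)
  then have e: "int (2 * k + 1) + (tri (n - 1) + (tri r + (2 * int k + 2 - (n - 1)) * r))
      = tri n + (tri (r + 1) + (2 * int k + 2 - n) * (r + 1))" by simp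
  have "q ^ (2 * k + 1) * lerch_term k (n - 1) r = (- 1) powi r *
      (q powi int (2 * k + 1) * (q powi tri (n - 1) * q powi (tri r + (2 * int k + 2 - (n - 1)) * r)))"
    unfolding lerch_term_def power_int_of_nat by (simp only: mult_ac)
  also have "\<dots> = (- 1) powi r * (q powi tri n * q powi (tri (r + 1) + (2 * int k + 2 - n) * (r + 1)))"
    by (simp only: q_powi_add[OF q0 q1, symmetric] e)
  also have "\<dots> = - lerch_term k n (r + 1)"
    by (simp add: lerch_term_def power_int_add)
  finally show ?thesis .
qed

text \<open>Coefficient form of (1 + z q^(2k+1)) A(z) = theta(z): shifting r by one leaves only the
  term r = 0.\<close>

lemma lerch_coeff_recurrence:
  "lerch_coeff k n + q ^ (2 * k + 1) * lerch_coeff k (n - 1) = q powi tri n"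
proof -
  have "((\<lambda>r. q ^ (2 * k + 1) * lerch_term k (n - 1) r) has_sum q ^ (2 * k + 1) * lerch_coeff k (n - 1)) {0..}"
    unfolding lerch_coeff_def by (intro has_sum_cmult_right has_sum_infsum lerch_term_summable)
  then have "((\<lambda>r. - lerch_term k n (r + 1)) has_sum q ^ (2 * k + 1) * lerch_coeff k (n - 1)) {0..}"
    by (simp only: lerch_term_shift)
  then have "((\<lambda>r. - lerch_term k n r) has_sum q ^ (2 * k + 1) * lerch_coeff k (n - 1)) {1..}"
    by (subst has_sum_reindex_bij_witness[of _ "\<lambda>r. r + 1" "\<lambda>r. r - 1" "{0..}" "\<lambda>r. - lerch_term k n (r + 1)"]) auto
  then have "(lerch_term k n has_sum - (q ^ (2 * k + 1) * lerch_coeff k (n - 1))) {1..}"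
    by (simp add: has_sum_uminus)
  then have "(lerch_term k n has_sum (lerch_term k n 0 + - (q ^ (2 * k + 1) * lerch_coeff k (n - 1)))) (insert 0 {1..})"
    by (intro has_sum_insert) auto
  moreover have "insert 0 {1..} = {0::int..}" by auto
  ultimately have "lerch_coeff k n = lerch_term k n 0 + - (q ^ (2 * k + 1) * lerch_coeff k (n - 1))"
    unfolding lerch_coeff_def by (simp add: infsumI)
  then show ?thesis
    by (simp add: lerch_term_def)
qed

lemma theta_const_summable: "(\<lambda>r. norm q powi tri r) summable_on A"
  using theta_summable_real[of 1 "norm q"] q0 q1 by (auto intro: summable_on_subset)

text \<open>For \<open>n > 2 * k + 2\<close> the defining series of the coefficient has large initial terms; the
  vanishing of the bilateral sum replaces it by the complementary series.\<close>

lemma lerch_coeff_bound: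
  "norm (lerch_coeff k n) \<le> (\<Sum>\<^sub>\<infinity>r. norm q powi tri r) * norm q powi tri n"
proof -
  have aux: "norm (infsum (lerch_term k n) A) \<le> (\<Sum>\<^sub>\<infinity>r. norm q powi tri r) * norm q powi tri n"
    if A: "\<And>r. r \<in> A \<Longrightarrow> (2 * int k + 2 - n) * r \<ge> 0" for A
  proof -
    have le: "norm (lerch_term k n r) \<le> norm q powi tri n * norm q powi tri r" if "r \<in> A" for r
    proof -
      have "norm q powi (tri r + (2 * int k + 2 - n) * r) \<le> norm q powi tri r"
        using A[OF that] q0 q1 by (intro power_int_decreasing) auto
      then show ?thesis
        unfolding lerch_term_def norm_mult norm_power_int
        by (intro mult_left_mono) (auto simp: norm_power_int)
    qed
    have smr: "(\<lambda>r. norm q powi tri n * norm q powi tri r) summable_on A"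
      by (intro summable_on_cmult_right theta_const_summable)
    have "norm (infsum (lerch_term k n) A) \<le> infsum (\<lambda>r. norm q powi tri n * norm q powi tri r) A"
      by (rule norm_infsum_le[OF has_sum_infsum has_sum_infsum]) (use smr lerch_term_summable le in auto)
    also have "\<dots> = norm q powi tri n * infsum (\<lambda>r. norm q powi tri r) A"
      by (rule infsum_cmult_right')
    also have "\<dots> \<le> norm q powi tri n * infsum (\<lambda>r. norm q powi tri r) UNIV"
      by (intro mult_left_mono infsum_mono_neutral theta_const_summable) auto
    finally show ?thesis by (simp add: mult.commute)
  qed
  show ?thesis
  proof (cases "n \<le> 2 * int k + 2")
    case True
    then show ?thesis
      unfolding lerch_coeff_def by (intro aux) auto
  next
    case False
    have "infsum (lerch_term k n) ({0..} \<union> {..<0}) = infsum (lerch_term k n) {0..} + infsum (lerch_term k n) {..<0}"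
      by (intro infsum_Un_disjoint lerch_term_summable) auto
    moreover have "{0..} \<union> {..<0} = (UNIV :: int set)" by auto
    ultimately have "lerch_coeff k n = - infsum (lerch_term k n) {..<0}"
      using infsumI[OF lerch_term_has_sum_0, of k n] by (simp add: lerch_coeff_def eq_neg_iff_add_eq_0)
    moreover have "norm (infsum (lerch_term k n) {..<0}) \<le> (\<Sum>\<^sub>\<infinity>r. norm q powi tri r) * norm q powi tri n"
      by (rule aux) (use False in \<open>auto intro!: mult_nonpos_nonpos\<close>)
    ultimately show ?thesis by simp
  qed
qed

lemma lerch_coeff_abs_summable:
  assumes "z \<noteq> 0"
  shows "(\<lambda>n. norm (lerch_coeff k n * z powi n)) summable_on UNIV"
proof (rule Infinite_Sum.abs_summable_on_comparison_test')
  show "(\<lambda>n. (\<Sum>\<^sub>\<infinity>r. norm q powi tri r) * norm (z powi n * q powi tri n)) summable_on UNIV"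
    by (intro summable_on_cmult_right theta_abs_summable q0 q1 assms)
  show "norm (lerch_coeff k n * z powi n) \<le> (\<Sum>\<^sub>\<infinity>r. norm q powi tri r) * norm (z powi n * q powi tri n)" for n
    using mult_right_mono[OF lerch_coeff_bound[of k n], of "norm (z powi n)"]
    by (simp add: norm_mult norm_power_int ac_simps)
qed

text \<open>Summing the recurrence against z^n gives (1 + z q^(2k+1)) S = theta. This reaches beyond
  the disc of the geometric expansion because the coefficients are absolutely summable for every
  nonzero z.\<close>

lemma lerch_coeff_has_sum:
  assumes z: "z \<noteq> 0" and pole: "1 + z * q ^ (2 * k + 1) \<noteq> 0"
  shows "((\<lambda>n. lerch_coeff k n * z powi n) has_sum
    (qpoch_inf (- z) q * qpoch_inf (- q / z) q * qpoch_inf q q) / (1 + z * q ^ (2 * k + 1))) UNIV"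
proof -
  define S where "S = (\<Sum>\<^sub>\<infinity>n. lerch_coeff k n * z powi n)"
  have S: "((\<lambda>n. lerch_coeff k n * z powi n) has_sum S) UNIV"
    unfolding S_def by (rule has_sum_infsum[OF abs_summable_summable[OF lerch_coeff_abs_summable[OF z]]])
  have "((\<lambda>n. lerch_coeff k (n - 1) * z powi (n - 1)) has_sum S) UNIV"
    using S by (subst has_sum_reindex_bij_witness[of _ "\<lambda>n. n + 1" "\<lambda>n. n - 1" _ "\<lambda>n. lerch_coeff k n * z powi n"]) auto
  then have "((\<lambda>n. (z * q ^ (2 * k + 1)) * (lerch_coeff k (n - 1) * z powi (n - 1))) has_sum (z * q ^ (2 * k + 1)) * S) UNIV"
    by (rule has_sum_cmult_right)
  with S have "((\<lambda>n. lerch_coeff k n * z powi n + (z * q ^ (2 * k + 1)) * (lerch_coeff k (n - 1) * z powi (n - 1)))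
      has_sum (S + (z * q ^ (2 * k + 1)) * S)) UNIV"
    by (rule has_sum_add)
  also have "(\<lambda>n. lerch_coeff k n * z powi n + (z * q ^ (2 * k + 1)) * (lerch_coeff k (n - 1) * z powi (n - 1)))
      = (\<lambda>n. z powi n * q powi tri n)"
  proof
    fix n
    have 1: "z * z powi (n - 1) = z powi n"
      using z power_int_minus_mult[of z n] by (simp add: mult.commute)
    have "(z * q ^ (2 * k + 1)) * (lerch_coeff k (n - 1) * z powi (n - 1))
        = (z * z powi (n - 1)) * (q ^ (2 * k + 1) * lerch_coeff k (n - 1))"
      by (simp only: mult_ac)
    then have "(z * q ^ (2 * k + 1)) * (lerch_coeff k (n - 1) * z powi (n - 1)) = z powi n * (q ^ (2 * k + 1) * lerch_coeff k (n - 1))"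
      by (simp only: 1)
    then show "lerch_coeff k n * z powi n + (z * q ^ (2 * k + 1)) * (lerch_coeff k (n - 1) * z powi (n - 1)) = z powi n * q powi tri n"
      unfolding lerch_coeff_recurrence[of k n, symmetric] distrib_left by (simp only: mult.commute)
  qed
  finally have "S + (z * q ^ (2 * k + 1)) * S = qpoch_inf (- z) q * qpoch_inf (- q / z) q * qpoch_inf q q"
    using jacobi_triple_product[OF q0 q1 z] by (rule has_sum_unique)
  then have "S = (qpoch_inf (- z) q * qpoch_inf (- q / z) q * qpoch_inf q q) / (1 + z * q ^ (2 * k + 1))"
    using pole by (simp add: eq_divide_eq algebra_simps)
  with S show ?thesis by simp
qed

end

section \<open>Coefficients of the Appell-Lerch sum and partial sums of an inverse theta
  series\<close>

context
  fixes q :: complex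
  assumes q0: "q \<noteq> 0" and q1: "norm q < 1"
begin

text \<open>The T of the overview. The negative branch is the odd extension, which keeps the same
  recurrence because \<open>tri (- n) = tri (n + 1)\<close>.\<close>

definition inv_theta_sum :: "int \<Rightarrow> complex" where
  "inv_theta_sum n = (if n \<ge> 0 then \<Sum>j=1..n. q powi (- tri j) else - (\<Sum>j=1..-n. q powi (- tri j)))"

lemma inv_theta_sum_0 [simp]: "inv_theta_sum 0 = 0"
  by (simp add: inv_theta_sum_def)

lemma inv_theta_sum_minus: "inv_theta_sum (- n) = - inv_theta_sum n"
  by (cases n "0 :: int" rule: linorder_cases) (simp_all add: inv_theta_sum_def)

lemma inv_theta_sum_Suc: "inv_theta_sum (n + 1) = inv_theta_sum n + q powi (- tri (n + 1))"
proof -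
  have pos: "inv_theta_sum (n + 1) = inv_theta_sum n + q powi (- tri (n + 1))" if "n \<ge> 0" for n
  proof -
    have "{1..n + 1} = insert (n + 1) {1..n}" using that by auto
    then show ?thesis using that by (simp add: inv_theta_sum_def add.commute)
  qed
  show ?thesis
  proof (cases "n \<ge> 0")
    \<comment> \<open>The nonnegative case at -n - 1 is carried over by oddness.\<close>
    case False
    have "inv_theta_sum (- n - 1 + 1) = inv_theta_sum (- n - 1) + q powi (- tri (- n - 1 + 1))"
      by (rule pos) (use False in auto)
    moreover have "inv_theta_sum (- n - 1) = - inv_theta_sum (n + 1)"
      using inv_theta_sum_minus[of "n + 1"] by simp
    moreover have "tri (- n) = tri (n + 1)"
      by (simp add: tri_minus tri_Suc)
    ultimately have "- inv_theta_sum n = - inv_theta_sum (n + 1) + q powi (- tri (n + 1))"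
      by (simp add: inv_theta_sum_minus)
    then show ?thesis by algebra
  qed (use pos in auto)
qed

lemma inv_theta_sum_diff:
  "inv_theta_sum (n + int N) - inv_theta_sum n = (\<Sum>r<N. q powi (- tri (n + int r + 1)))"
proof (induction N)
  case (Suc N)
  have "inv_theta_sum (n + int (Suc N)) = inv_theta_sum (n + int N) + q powi (- tri (n + int N + 1))"
    using inv_theta_sum_Suc[of "n + int N"] by (simp add: ac_simps)
  with Suc.IH show ?case by simp
qed simp

lemma inv_theta_sum_bound: "norm (inv_theta_sum (int m)) \<le> real m * norm q powi (- tri (int m))"
proof -
  have "norm (inv_theta_sum (int m)) \<le> (\<Sum>j=1..int m. norm q powi (- tri j))"
    unfolding inv_theta_sum_def by (auto intro!: sum_norm_le simp: norm_power_int)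
  also have "\<dots> \<le> (\<Sum>j=1..int m. norm q powi (- tri (int m)))"
  proof (rule sum_mono)
    fix j assume j: "j \<in> {1..int m}"
    have "2 * tri j \<le> 2 * tri (int m)"
      unfolding tri_double using j by (intro mult_mono) auto
    then show "norm q powi (- tri j) \<le> norm q powi (- tri (int m))"
      using q0 q1 by (intro power_int_decreasing) auto
  qed
  also have "\<dots> = real m * norm q powi (- tri (int m))"
    by simp
  finally show ?thesis .
qed

text \<open>For N >= 0, T(N) grows at most like N |q|^(-tri N), while N^2 - tri N = tri N + N; the
  factor N is absorbed into 2^N. Negative N follow by oddness.\<close>

lemma gauss_inv_theta_summable:
  "(\<lambda>N. (- 1) powi N * q powi (N ^ 2) * inv_theta_sum N) summable_on UNIV"
proof (rule abs_summable_summable, rule summable_on_int)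
  define r where "r = norm q"
  have r: "0 < r" "r < 1" using q0 q1 by (auto simp: r_def)
  have bound: "norm ((- 1) powi int m * q powi (int m ^ 2) * inv_theta_sum (int m)) \<le> (2 * r) ^ m * r ^ (m choose 2)" for m
  proof -
    have "norm ((- 1) powi int m * q powi (int m ^ 2) * inv_theta_sum (int m))
        = r powi (2 * tri (int m) + int m) * norm (inv_theta_sum (int m))"
      by (simp add: norm_mult norm_power_int norm_power r_def tri_square)
    also have "\<dots> \<le> r powi (2 * tri (int m) + int m) * (real m * r powi (- tri (int m)))"
      using inv_theta_sum_bound[of m] r by (intro mult_left_mono) (auto simp: r_def)
    also have "\<dots> = real m * (r powi (2 * tri (int m) + int m) * r powi (- tri (int m)))"
      by (simp only: mult_ac)
    also have "r powi (2 * tri (int m) + int m) * r powi (- tri (int m)) = r ^ m * r ^ (m choose 2)"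
      using r by (simp flip: power_int_of_nat power_int_add add: tri_of_nat add.commute)
    also have "real m * (r ^ m * r ^ (m choose 2)) \<le> 2 ^ m * (r ^ m * r ^ (m choose 2))"
      using r by (intro mult_right_mono) (auto simp: less_imp_le of_nat_less_two_power)
    finally show ?thesis by (simp add: power_mult_distrib mult.assoc)
  qed
  have s: "summable (\<lambda>m. (2 * r) ^ m * r ^ (m choose 2))"
    using r by (intro summable_power_choose_two) auto
  show 1: "summable (\<lambda>m. norm ((- 1) powi int m * q powi (int m ^ 2) * inv_theta_sum (int m)))"
    by (rule summable_comparison_test'[OF s, of 0]) (use bound in auto)
  have "norm ((- 1) powi (- int m) * q powi ((- int m) ^ 2) * inv_theta_sum (- int m))
      = norm ((- 1) powi int m * q powi (int m ^ 2) * inv_theta_sum (int m))" for m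
    by (simp add: inv_theta_sum_minus norm_mult norm_power_int norm_power)
  with 1 show "summable (\<lambda>m. norm ((- 1) powi (- int m) * q powi ((- int m) ^ 2) * inv_theta_sum (- int m)))"
    by simp
qed simp

text \<open>N^2 - tri(n + N + 1) = tri N - n N - tri(n + 1), so this is a constant times theta at
  the zero -q^(-n).\<close>

lemma gauss_inv_theta_step:
  "((\<lambda>N. (- 1) powi N * q powi (N ^ 2) * q powi (- tri (n + N + 1))) has_sum 0) UNIV"
proof -
  have "((\<lambda>N. q powi (- tri (n + 1)) * ((- 1) powi N * q powi (tri N + - n * N))) has_sum q powi (- tri (n + 1)) * 0) UNIV"
    by (intro has_sum_cmult_right theta_vanishes q0 q1)
  also have "(\<lambda>N. q powi (- tri (n + 1)) * ((- 1) powi N * q powi (tri N + - n * N)))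
      = (\<lambda>N. (- 1) powi N * q powi (N ^ 2) * q powi (- tri (n + N + 1)))"
  proof
    fix N
    have "tri (n + N + 1) = tri N + tri (n + 1) + N * (n + 1)"
      using tri_add[of N "n + 1"] by (simp add: ac_simps)
    then have e: "- tri (n + 1) + (tri N + - n * N) = N ^ 2 + - tri (n + N + 1)"
      unfolding tri_square by (simp add: algebra_simps)
    have "q powi (- tri (n + 1)) * q powi (tri N + - n * N) = q powi (N ^ 2) * q powi (- tri (n + N + 1))"
      by (simp only: q_powi_add[OF q0 q1, symmetric] e)
    then show "q powi (- tri (n + 1)) * ((- 1) powi N * q powi (tri N + - n * N))
        = (- 1) powi N * q powi (N ^ 2) * q powi (- tri (n + N + 1))"
      by (simp only: mult.left_commute[of _ "(- 1) powi N"] mult.assoc)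
  qed
  finally show ?thesis by simp
qed

lemma gauss_inv_theta_has_sum_0:
  "((\<lambda>N. (- 1) powi N * q powi (N ^ 2) * inv_theta_sum (n + N)) has_sum 0) UNIV"
proof (induction n rule: int_induct[of _ 0])
  case base
  show ?case
    using has_sum_odd[OF gauss_inv_theta_summable]
    by (simp add: inv_theta_sum_minus power_int_minus_one_minus)
next
  case (step1 n)
  have "inv_theta_sum (n + 1 + N) = inv_theta_sum (n + N) + q powi (- tri (n + N + 1))" for N
    using inv_theta_sum_Suc[of "n + N"] by (simp add: ac_simps)
  then show ?case
    using has_sum_add[OF step1(2) gauss_inv_theta_step[of n]] by (simp add: distrib_left)
next
  case (step2 n)
  have "inv_theta_sum (n - 1 + N) = inv_theta_sum (n + N) - q powi (- tri (n - 1 + N + 1))" for N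
    using inv_theta_sum_Suc[of "n - 1 + N"] by (simp add: ac_simps)
  then have eq: "(- 1) powi N * q powi (N ^ 2) * inv_theta_sum (n - 1 + N) =
      (- 1) powi N * q powi (N ^ 2) * inv_theta_sum (n + N)
      + - 1 * ((- 1) powi N * q powi (N ^ 2) * q powi (- tri (n - 1 + N + 1)))" for N
    by (simp add: right_diff_distrib)
  show ?case
    unfolding eq
    using has_sum_add[OF step2(2) has_sum_cmult_right[OF gauss_inv_theta_step[of "n - 1"], of "- 1"]]
    by simp
qed

text \<open>For N >= 1 the difference of T collects the terms r < N of the regrouped double sum.
  Written through T it also makes sense for negative N, which allows completion to a bilateral
  sum.\<close>

definition gauss_diff :: "int \<Rightarrow> int \<Rightarrow> complex" where
  "gauss_diff n N = (- 1) powi N * q powi (N ^ 2) * (inv_theta_sum (n + N) - inv_theta_sum n)"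

text \<open>The part with T(n + N) sums to 0, leaving -T(n) times the value in
  \<open>gauss_theta\<close>.\<close>

lemma gauss_diff_has_sum:
  "(gauss_diff n has_sum - (inv_theta_sum n / conj_bailey_const q)) UNIV"
proof -
  have "((\<lambda>N. (- 1) powi N * q powi (N ^ 2) * inv_theta_sum (n + N) + ((- 1) powi N * q powi (N ^ 2)) * (- inv_theta_sum n))
     has_sum (0 + (1 / conj_bailey_const q) * (- inv_theta_sum n))) UNIV"
    by (intro has_sum_add gauss_inv_theta_has_sum_0 has_sum_cmult_left gauss_theta q0 q1)
  then show ?thesis
    by (simp add: gauss_diff_def[abs_def] algebra_simps)
qed

lemma gauss_diff_minus: "gauss_diff (- n) N = - gauss_diff n (- N)"
proof -
  have "inv_theta_sum (- n + N) = - inv_theta_sum (n - N)"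
    using inv_theta_sum_minus[of "n - N"] by simp
  then show ?thesis
    by (simp add: gauss_diff_def inv_theta_sum_minus power_int_minus_one_minus algebra_simps)
qed

text \<open>The coefficient of z^n in theta(z) times the sum over k of (-1)^k q^((k+1)^2) / (1 + z
  q^(2k+1)).\<close>

definition lerch_total :: "int \<Rightarrow> complex" where
  "lerch_total n = (\<Sum>\<^sub>\<infinity>k. (- 1) ^ k * q ^ (Suc k ^ 2) * lerch_coeff q k n)"

text \<open>Reindexing by \<open>N = k + r + 1\<close> makes the exponent
  \<open>(k + 1)\<^sup>2 + (2 * k + 1) * r + tri (n - r)\<close> equal to \<open>N\<^sup>2 + n\<^sup>2 - tri (n + r + 1)\<close>.\<close>

lemma lerch_total_eq: "lerch_total n = - (q powi (n ^ 2)) * infsum (gauss_diff n) {1..}"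
proof -
  define r0 where "r0 = norm q"
  have r0: "0 < r0" "r0 < 1" using q0 q1 by (auto simp: r0_def)
  define f where "f = (\<lambda>(k, r). (- 1) ^ k * q ^ (Suc k ^ 2) * lerch_term q k n (int r))"
  have f_norm: "norm (f (k, r)) \<le> r0 ^ k * (r0 powi tri n * ((r0 powi (- n)) ^ r * r0 ^ (r choose 2)))" for k r
  proof -
    have a: "norm (f (k, r)) = r0 ^ (Suc k ^ 2) * (r0 powi tri n * r0 powi (tri (int r) + (2 * int k + 2 - n) * int r))"
      by (simp add: f_def lerch_term_def[OF q0 q1] norm_mult norm_power norm_power_int r0_def)
    have "k \<le> Suc k ^ 2" by (simp add: power2_eq_square)
    then have b: "r0 ^ (Suc k ^ 2) \<le> r0 ^ k"
      using r0 by (intro power_decreasing) auto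
    \<comment> \<open>Dropping (2k + 2) r >= 0 from the exponent decouples k and r, so the majorant
      is a product.\<close>
    have "r0 powi (tri (int r) + (2 * int k + 2 - n) * int r) \<le> r0 powi (tri (int r) + - n * int r)"
      using r0 by (intro power_int_decreasing) (auto simp: algebra_simps)
    also have "\<dots> = (r0 powi (- n)) ^ r * r0 ^ (r choose 2)"
      unfolding power_int_power' power_int_of_nat[of r0 "r choose 2", symmetric] tri_of_nat
      using r0 by (subst power_int_add) (simp_all only: mult.commute, simp)
    finally show ?thesis
      unfolding a using r0 b by (intro mult_mono) auto
  qed
  have "summable (\<lambda>r. norm ((r0 powi (- n)) ^ r * r0 ^ (r choose 2)))"
    using r0 by (simp add: summable_power_choose_two)
  then have "(\<lambda>r. (r0 powi (- n)) ^ r * r0 ^ (r choose 2)) summable_on UNIV"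
    by (rule norm_summable_imp_summable_on)
  moreover have "(\<lambda>k. r0 ^ k) summable_on UNIV"
    using r0 by (intro norm_summable_imp_summable_on) (simp add: summable_geometric)
  ultimately have "(\<lambda>(k, r). r0 ^ k * (r0 powi tri n * ((r0 powi (- n)) ^ r * r0 ^ (r choose 2)))) summable_on UNIV \<times> UNIV"
    using r0 by (intro summable_on_product_real summable_on_cmult_right) auto
  then have "(\<lambda>x. norm (f x)) summable_on UNIV \<times> UNIV"
    by (rule Infinite_Sum.abs_summable_on_comparison_test') (use f_norm in auto)
  then have f: "f summable_on UNIV \<times> UNIV"
    by (rule abs_summable_summable)
  then have f_sum: "(f has_sum infsum f (UNIV \<times> UNIV)) (UNIV \<times> UNIV)"
    by simp
  have "((\<lambda>k. (- 1) ^ k * q ^ (Suc k ^ 2) * lerch_coeff q k n) has_sum infsum f (UNIV \<times> UNIV)) UNIV"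
  proof (rule has_sum_SigmaD[OF f_sum])
    fix k :: nat
    have "(lerch_term q k n has_sum lerch_coeff q k n) {0..}"
      unfolding lerch_coeff_def[OF q0 q1] by (intro has_sum_infsum lerch_term_summable q0 q1)
    then have "((\<lambda>r. lerch_term q k n (int r)) has_sum lerch_coeff q k n) UNIV"
      by (subst has_sum_reindex_bij_witness[of _ nat int "{0..}" "lerch_term q k n"]) auto
    then show "((\<lambda>r. f (k, r)) has_sum (- 1) ^ k * q ^ (Suc k ^ 2) * lerch_coeff q k n) UNIV"
      unfolding f_def by (auto intro: has_sum_cmult_right)
  qed
  then have total: "lerch_total n = infsum f (UNIV \<times> UNIV)"
    unfolding lerch_total_def by (rule infsumI)
  \<comment> \<open>The leading minus comes from (-1)^(k + r) = -(-1)^N.\<close>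
  define g where "g = (\<lambda>(N, r). - (q powi (n ^ 2)) * ((- 1) powi int N * q powi (int N ^ 2) * q powi (- tri (n + int r + 1))))"
  have fg: "g (k + r + 1, r) = f (k, r)" for k r
  proof -
    have "2 * (n ^ 2 + (int (k + r + 1) ^ 2 + - tri (n + int r + 1)))
        = 2 * (int (Suc k ^ 2) + (tri n + (tri (int r) + (2 * int k + 2 - n) * int r)))"
      unfolding distrib_left mult_minus_right tri_double by (simp add: algebra_simps power2_eq_square)
    then have e: "n ^ 2 + (int (k + r + 1) ^ 2 + - tri (n + int r + 1))
        = int (Suc k ^ 2) + (tri n + (tri (int r) + (2 * int k + 2 - n) * int r))" by simp
    have "g (k + r + 1, r) = (- 1) ^ (k + r) * (q powi (n ^ 2) * (q powi (int (k + r + 1) ^ 2) * q powi (- tri (n + int r + 1))))"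
      unfolding g_def prod.case power_int_of_nat by (simp only: power_add power_one_right mult_ac mult_minus_right mult_minus_left mult_1 minus_minus)
    also have "\<dots> = (- 1) ^ (k + r) * (q powi int (Suc k ^ 2) * (q powi tri n * q powi (tri (int r) + (2 * int k + 2 - n) * int r)))"
      by (simp only: q_powi_add[OF q0 q1, symmetric] e)
    also have "\<dots> = f (k, r)"
      unfolding f_def prod.case lerch_term_def[OF q0 q1] power_int_of_nat power_add by (simp only: mult_ac)
    finally show ?thesis .
  qed
  \<comment> \<open>At fixed N only r < N occurs, so the inner sums become finite.\<close>
  have "(f has_sum infsum f (UNIV \<times> UNIV)) (UNIV \<times> UNIV) =
      (g has_sum infsum f (UNIV \<times> UNIV)) (Sigma {1..} (\<lambda>N. {..<N}))"
    by (rule has_sum_reindex_bij_witness[of _ "\<lambda>(N, r). (N - r - 1, r)" "\<lambda>(k, r). (k + r + 1, r)"])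
      (auto simp: fg simp del: One_nat_def)
  with f_sum have "(g has_sum infsum f (UNIV \<times> UNIV)) (Sigma {1..} (\<lambda>N. {..<N}))" by simp
  then have "((\<lambda>N. - (q powi (n ^ 2)) * gauss_diff n (int N)) has_sum infsum f (UNIV \<times> UNIV)) {1..}"
  proof (rule has_sum_SigmaD)
    fix N :: nat
    show "((\<lambda>r. g (N, r)) has_sum - (q powi (n ^ 2)) * gauss_diff n (int N)) {..<N}"
      by (rule has_sum_finiteI) (simp_all add: g_def gauss_diff_def inv_theta_sum_diff sum_distrib_left mult.assoc)
  qed
  then have "((\<lambda>N. - (q powi (n ^ 2)) * gauss_diff n N) has_sum infsum f (UNIV \<times> UNIV)) {1..}"
    by (subst has_sum_reindex_bij_witness[of _ int nat "{1..}" "\<lambda>N. - (q powi (n ^ 2)) * gauss_diff n (int N)"]) auto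
  then have "infsum f (UNIV \<times> UNIV) = (\<Sum>\<^sub>\<infinity>N\<in>{1..}. - (q powi (n ^ 2)) * gauss_diff n N)"
    by (rule infsumI[symmetric])
  then show ?thesis
    unfolding total infsum_cmult_right' .
qed

text \<open>Reflecting N turns the half-line sum for -n into minus the sum over N <= -1 for n. The
  difference is thus the full bilateral sum, its term N = 0 being zero.\<close>

lemma lerch_total_antisym:
  "lerch_total n - lerch_total (- n) = q powi (n ^ 2) * inv_theta_sum n / conj_bailey_const q"
proof -
  note smr = has_sum_imp_summable[OF gauss_diff_has_sum, of n]
  have smr': "gauss_diff n summable_on A" for A
    by (rule summable_on_subset[OF smr]) auto
  have "infsum (gauss_diff (- n)) {1..} = (\<Sum>\<^sub>\<infinity>N\<in>{1..}. - gauss_diff n (- N))"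
    by (rule infsum_cong) (rule gauss_diff_minus)
  also have "\<dots> = - infsum (gauss_diff n) {..-1}"
    unfolding infsum_uminus
    by (intro arg_cong[of _ _ uminus] infsum_reindex_bij_witness[of _ uminus uminus]) auto
  finally have m: "infsum (gauss_diff (- n)) {1..} = - infsum (gauss_diff n) {..-1}" .
  have "infsum (gauss_diff n) ({1..} \<union> {..-1}) = infsum (gauss_diff n) {1..} + infsum (gauss_diff n) {..-1}"
    by (intro infsum_Un_disjoint smr') auto
  moreover have "infsum (gauss_diff n) ({1..} \<union> {..-1}) = infsum (gauss_diff n) UNIV"
  proof (rule infsum_cong_neutral)
    fix N assume "N \<in> UNIV - ({1..} \<union> {..-1 :: int})"
    then have "N = 0" by auto
    then show "gauss_diff n N = 0" by (simp add: gauss_diff_def)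
  qed auto
  ultimately have "infsum (gauss_diff n) {1..} + infsum (gauss_diff n) {..-1} = - (inv_theta_sum n / conj_bailey_const q)"
    using infsumI[OF gauss_diff_has_sum, of n] by simp
  moreover have "lerch_total n - lerch_total (- n)
      = - (q powi (n ^ 2)) * (infsum (gauss_diff n) {1..} + infsum (gauss_diff n) {..-1})"
    unfolding lerch_total_eq m by (simp add: algebra_simps)
  ultimately show ?thesis by simp
qed

end

subsection \<open>The series \<open>F4\<close> as an Appell-Lerch sum\<close>

context
  fixes q z :: complex
  assumes q0: "q \<noteq> 0" and q1: "norm q < 1" and z0: "z \<noteq> 0"
    and pole1: "\<And>k. 1 + z * q ^ (2 * k + 1) \<noteq> 0"
    and pole2: "\<And>k. 1 + q ^ (2 * k + 1) / z \<noteq> 0"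
begin

definition denom :: "nat \<Rightarrow> complex" where
  "denom k = (1 + z * q ^ (2 * k + 1)) * (1 + q ^ (2 * k + 1) / z)"

lemma denom_nonzero: "denom k \<noteq> 0"
  using pole1 pole2 by (simp add: denom_def)

lemma denom_inverse_bounded:
  obtains B where "B > 0" "\<And>k. norm (inverse (denom k)) \<le> B"
proof -
  have "(\<lambda>k. q ^ (2 * k + 1)) \<longlonglongrightarrow> 0"
    using LIMSEQ_power_zero[OF q1] by (rule filterlim_compose) real_asymp
  then have "(\<lambda>k. inverse ((1 + z * q ^ (2 * k + 1)) * (1 + q ^ (2 * k + 1) / z))) \<longlonglongrightarrow> inverse ((1 + z * 0) * (1 + 0 / z))"
    using z0 by (intro tendsto_intros) auto
  then have "Bseq (\<lambda>k. inverse (denom k))"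
    unfolding denom_def by (rule convergent_imp_Bseq[OF convergentI])
  then show thesis using that by (metis BseqE)
qed

lemma qpochs_eq_denom:
  "qpochs [z * (- q), (- q) / z] ((- q) ^ 2) (n + 1) = (\<Prod>k\<le>n. denom k)"
  by (simp add: qpochs_def qpoch_def denom_def prod.distrib power_mult lessThan_Suc_atMost mult.assoc
      flip: prod.distrib)

text \<open>Replacing q by -q turns (q;-q)_(2n) into (-q;q)_(2n), and the signs collapse to
  -q^(n+1).\<close>

lemma F4_term_eq:
  "F4_term z (- q) n = (\<Sum>k\<le>n. - ((- 1) ^ k * q ^ (Suc k ^ 2) * (1 - q ^ (4 * k + 2)) / denom k)
     * conj_bailey_term q k (n - k))"
proof -
  have sign: "(- 1) ^ n * (- q) ^ (n + 1) = - (q ^ (n + 1))"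
    by (simp add: power_minus[of q])
  have "F4_term z (- q) n = ((- 1) ^ n * (- q) ^ (n + 1)) * qpoch (- q) q (2 * n) * (1 / (\<Prod>k\<le>n. denom k))"
    unfolding F4_term_def qpochs_eq_denom minus_minus
    unfolding divide_inverse mult_1_left by (simp only: mult_ac)
  also note sign
  also have "1 / (\<Prod>k\<le>n. denom k) = (\<Sum>k\<le>n. (- 1) ^ k * (q ^ 2) ^ (Suc k choose 2) *
      (1 - q ^ (4 * k + 2)) / (qpoch (q^2) (q^2) (n - k) * qpoch (q^2) (q^2) (n + k + 1)) / denom k)"
    using partial_fractions[OF q0 q1 z0, of n] denom_nonzero unfolding denom_def by blast
  finally show ?thesis
    unfolding sum_distrib_left
  proof (elim ssubst, intro sum.cong refl)
    fix k assume "k \<in> {..n}"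
    then have k: "k \<le> n" by simp
    then obtain m where n: "n = m + k" by (metis le_iff_add add.commute)
    \<comment> \<open>Separates the power of q into a part in k alone and the q^m of the inner
      sum.\<close>
    have "n + 1 + 2 * (Suc k choose 2) = (Suc k) ^ 2 + m"
    proof -
      have "int (n + 1 + 2 * (Suc k choose 2)) = int ((Suc k) ^ 2 + m)"
        unfolding n of_nat_add of_nat_mult tri_of_nat of_nat_numeral tri_double
        by (simp add: power2_eq_square algebra_simps)
      then show ?thesis by (simp only: of_nat_eq_iff)
    qed
    then have "q ^ (n + 1) * (q ^ 2) ^ (Suc k choose 2) = q ^ ((Suc k) ^ 2) * q ^ m"
      by (simp only: power_mult[symmetric] power_add[symmetric])
    moreover have "n + k + 1 = m + 2 * k + 1" "n - k = m" using n by auto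
    moreover have "- E * P * (s * F * a / d / c) = - (s * Q * a / c) * (M * P / d)" if "E * F = Q * M"
      for E P s F a d c Q M :: complex
    proof -
      have "- E * P * (s * F * a / d / c) = - ((E * F) * (P * s * a) / (d * c))"
        by (simp add: mult_ac)
      then show ?thesis unfolding that by (simp add: mult_ac)
    qed
    ultimately show "- (q ^ (n + 1)) * qpoch (- q) q (2 * n) * ((- 1) ^ k * (q ^ 2) ^ (Suc k choose 2) *
      (1 - q ^ (4 * k + 2)) / (qpoch (q^2) (q^2) (n - k) * qpoch (q^2) (q^2) (n + k + 1)) / denom k)
      = - ((- 1) ^ k * q ^ (Suc k ^ 2) * (1 - q ^ (4 * k + 2)) / denom k) * conj_bailey_term q k (n - k)"
      unfolding conj_bailey_term_def[OF q0 q1] n[symmetric] by (simp only: n[symmetric])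
  qed
qed

definition lerch_summand :: "nat \<Rightarrow> complex" where
  "lerch_summand k = (- 1) ^ k * q ^ (Suc k ^ 2) * (1 - q ^ (2 * k + 1)) / denom k"

text \<open>The prefactors are O(|q|^k) and the inner terms O(|q|^m) uniformly in k, so the double
  sum converges absolutely and may be grouped by n = k + m or by k.\<close>

lemma F4_term_has_sum:
  "(F4_term z (- q) has_sum (\<Sum>\<^sub>\<infinity>k. - conj_bailey_const q * lerch_summand k)) UNIV"
proof -
  define e where "e k = - ((- 1) ^ k * q ^ (Suc k ^ 2) * (1 - q ^ (4 * k + 2)) / denom k)" for k
  define f where "f = (\<lambda>(k, m). e k * conj_bailey_term q k m)"
  obtain C where C: "C > 0" "\<And>k m. norm (conj_bailey_term q k m) \<le> C * norm q ^ m"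
    using conj_bailey_term_bound[OF q0 q1] by metis
  obtain B where B: "B > 0" "\<And>k. norm (inverse (denom k)) \<le> B"
    using denom_inverse_bounded by metis
  have geom: "(\<lambda>k. norm q ^ k) summable_on UNIV"
    using q1 by (intro norm_summable_imp_summable_on) (simp add: summable_geometric)
  have e: "norm (e k) \<le> 2 * B * norm q ^ k" for k
  proof -
    have "k \<le> Suc k ^ 2" by (simp add: power2_eq_square)
    then have 1: "norm (q ^ (Suc k ^ 2)) \<le> norm q ^ k"
      using q1 unfolding norm_power by (intro power_decreasing) auto
    have "norm (1 - q ^ (4 * k + 2)) \<le> 1 + norm (q ^ (4 * k + 2))"
      using norm_triangle_ineq4[of 1 "q ^ (4 * k + 2)"] by simp
    also have "norm (q ^ (4 * k + 2)) \<le> 1"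
      using q1 unfolding norm_power by (intro power_le_one) auto
    finally have 2: "norm (1 - q ^ (4 * k + 2)) \<le> 2" by simp
    have "norm (e k) = norm (q ^ (Suc k ^ 2)) * norm (1 - q ^ (4 * k + 2)) * norm (inverse (denom k))"
      unfolding e_def divide_inverse by (simp only: norm_minus_cancel norm_mult norm_power norm_one power_one mult_1)
    also have "\<dots> \<le> norm q ^ k * 2 * B"
      using 1 2 B by (intro mult_mono mult_nonneg_nonneg) auto
    finally show ?thesis by (simp only: mult_ac)
  qed
  have "(\<lambda>(k, m). 2 * B * norm q ^ k * (C * norm q ^ m)) summable_on UNIV \<times> UNIV"
    using B C by (intro summable_on_product_real summable_on_cmult_right geom) auto
  then have "(\<lambda>x. norm (f x)) summable_on UNIV \<times> UNIV"
  proof (rule Infinite_Sum.abs_summable_on_comparison_test')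
    fix x :: "nat \<times> nat"
    have "norm (e k * conj_bailey_term q k m) \<le> 2 * B * norm q ^ k * (C * norm q ^ m)" for k m
      unfolding norm_mult using e C B by (intro mult_mono) auto
    then show "norm (f x) \<le> (case x of (k, m) \<Rightarrow> 2 * B * norm q ^ k * (C * norm q ^ m))"
      by (auto simp: f_def split: prod.split)
  qed
  then have f: "f summable_on UNIV \<times> UNIV"
    by (rule abs_summable_summable)
  then have f_sum: "(f has_sum infsum f (UNIV \<times> UNIV)) (UNIV \<times> UNIV)" by simp
  have inner: "((\<lambda>m. f (k, m)) has_sum - conj_bailey_const q * lerch_summand k) UNIV" for k
  proof -
    have "summable (\<lambda>m. norm (conj_bailey_term q k m))"
      by (rule summable_comparison_test'[of "\<lambda>m. C * norm q ^ m" 0])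
        (use C q1 in \<open>auto intro!: summable_mult summable_geometric\<close>)
    then have "(conj_bailey_term q k has_sum conj_bailey_const q / (1 + q ^ (2 * k + 1))) UNIV"
      using conj_bailey_term_sums[OF q0 q1] by (rule norm_summable_imp_has_sum)
    then have "((\<lambda>m. f (k, m)) has_sum e k * (conj_bailey_const q / (1 + q ^ (2 * k + 1)))) UNIV"
      unfolding f_def prod.case by (rule has_sum_cmult_right)
    moreover have "1 + q ^ (2 * k + 1) \<noteq> 0"
      using qpoch_factor_nonzero[of q "- q" "2 * k"] q1 by simp
    \<comment> \<open>The factor 1 + x_k cancels the denominator of the q-Gauss value; hence the 1 -
      x_k in \<open>lerch_summand\<close>.\<close>
    have "1 - q ^ (4 * k + 2) = (1 - q ^ (2 * k + 1)) * (1 + q ^ (2 * k + 1))"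
    proof -
      have "q ^ (4 * k + 2) = q ^ (2 * k + 1) * q ^ (2 * k + 1)"
        unfolding power_add[symmetric] by (rule arg_cong[of _ _ "(^) q"]) simp
      then show ?thesis unfolding \<open>q ^ (4 * k + 2) = _\<close> by algebra
    qed
    then have "e k * (conj_bailey_const q / (1 + q ^ (2 * k + 1))) = - conj_bailey_const q * lerch_summand k"
      using \<open>1 + q ^ (2 * k + 1) \<noteq> 0\<close> unfolding e_def lerch_summand_def by (simp del: power_Suc)
    ultimately show ?thesis by simp
  qed
  have "((\<lambda>k. - conj_bailey_const q * lerch_summand k) has_sum infsum f (UNIV \<times> UNIV)) UNIV"
    by (rule has_sum_SigmaD[OF f_sum]) (rule inner)
  then have total: "infsum f (UNIV \<times> UNIV) = (\<Sum>\<^sub>\<infinity>k. - conj_bailey_const q * lerch_summand k)"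
    by (rule infsumI[symmetric])
  have "(f has_sum infsum f (UNIV \<times> UNIV)) (UNIV \<times> UNIV) =
      ((\<lambda>(n, k). f (k, n - k)) has_sum infsum f (UNIV \<times> UNIV)) (Sigma UNIV (\<lambda>n. {..n}))"
    by (rule has_sum_reindex_bij_witness[of _ "\<lambda>(n, k). (k, n - k)" "\<lambda>(k, m). (k + m, k)"]) auto
  with f_sum have "((\<lambda>(n, k). f (k, n - k)) has_sum infsum f (UNIV \<times> UNIV)) (Sigma UNIV (\<lambda>n. {..n}))"
    by simp
  then have "(F4_term z (- q) has_sum infsum f (UNIV \<times> UNIV)) UNIV"
  proof (rule has_sum_SigmaD)
    fix n :: nat
    show "((\<lambda>k. case (n, k) of (n, k) \<Rightarrow> f (k, n - k)) has_sum F4_term z (- q) n) {..n}"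
      by (rule has_sum_finiteI) (simp_all add: F4_term_eq f_def e_def)
  qed
  then show ?thesis unfolding total .
qed

abbreviation (input) theta :: complex where
  "theta \<equiv> qpochs_inf [- z * q, - 1 / z, q] q"

text \<open>The shift m -> m + 1 gives \<open>T z = z * theta\<close>, the reflection m -> -m gives
  \<open>T (1 / z) = theta\<close>. The two quotients then combine over the common denominator D_k
  with numerator -(1 - z)(1 - x_k).\<close>

lemma lerch_coeff_has_sum_diff:
  "((\<lambda>n. lerch_coeff q k n * (z powi n - z powi (- n))) has_sum
     - ((1 - z) * theta * ((1 - q ^ (2 * k + 1)) / denom k))) UNIV"
proof -
  define T where "T = (\<lambda>w. qpoch_inf (- w) q * qpoch_inf (- q / w) q * qpoch_inf q q)"
  have JTP: "((\<lambda>m. w powi m * q powi tri m) has_sum T w) UNIV" if "w \<noteq> 0" for w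
    unfolding T_def by (rule jacobi_triple_product[OF q0 q1 that])
  have theta: "theta = T (z * q)"
    using q0 by (simp add: qpochs_inf_def T_def mult.assoc)
  have "T z = z * theta"
  proof (rule has_sum_unique[OF JTP[OF z0]])
    have "((\<lambda>m. z * ((z * q) powi m * q powi tri m)) has_sum z * theta) UNIV"
      unfolding theta using z0 q0 by (intro has_sum_cmult_right JTP) auto
    also have "(\<lambda>m. z * ((z * q) powi m * q powi tri m)) = (\<lambda>m. z powi (m + 1) * q powi tri (m + 1))"
      using z0 q0 by (auto simp: power_int_mult_distrib power_int_add tri_Suc)
    finally show "((\<lambda>m. z powi m * q powi tri m) has_sum z * theta) UNIV"
      by (subst (asm) has_sum_reindex_bij_witness[of _ "\<lambda>m. m - 1" "\<lambda>m. m + 1" UNIV "\<lambda>m. z powi m * q powi tri m"]) auto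
  qed
  moreover have "T (1 / z) = theta"
  proof (rule has_sum_unique[OF JTP])
    have "((\<lambda>m. (z * q) powi m * q powi tri m) has_sum theta) UNIV"
      unfolding theta using z0 q0 by (intro JTP) auto
    also have "(\<lambda>m. (z * q) powi m * q powi tri m) = (\<lambda>m. (1 / z) powi (- m) * q powi tri (- m))"
      using z0 q0 by (auto simp: power_int_mult_distrib power_int_add tri_minus power_int_minus power_int_divide_distrib)
    finally show "((\<lambda>m. (1 / z) powi m * q powi tri m) has_sum theta) UNIV"
      by (subst (asm) has_sum_reindex_bij_witness[of _ uminus uminus UNIV "\<lambda>m. (1 / z) powi m * q powi tri m"]) auto
  qed (use z0 in auto)
  moreover have "((\<lambda>n. lerch_coeff q k n * z powi n) has_sum T z / (1 + z * q ^ (2 * k + 1))) UNIV"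
    unfolding T_def by (rule lerch_coeff_has_sum[OF q0 q1 z0 pole1])
  moreover have "((\<lambda>n. lerch_coeff q k n * (1 / z) powi n) has_sum T (1 / z) / (1 + (1 / z) * q ^ (2 * k + 1))) UNIV"
    unfolding T_def by (rule lerch_coeff_has_sum[OF q0 q1]) (use z0 pole2[of k] in auto)
  ultimately have "((\<lambda>n. lerch_coeff q k n * z powi n + - 1 * (lerch_coeff q k n * (1 / z) powi n)) has_sum
     (z * theta / (1 + z * q ^ (2 * k + 1)) + - 1 * (theta / (1 + (1 / z) * q ^ (2 * k + 1))))) UNIV"
    by (intro has_sum_add has_sum_cmult_right) simp_all
  also have "(\<lambda>n. lerch_coeff q k n * z powi n + - 1 * (lerch_coeff q k n * (1 / z) powi n))
      = (\<lambda>n. lerch_coeff q k n * (z powi n - z powi (- n)))"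
    by (simp add: fun_eq_iff power_int_minus power_int_inverse right_diff_distrib divide_inverse)
  also have "z * theta / (1 + z * q ^ (2 * k + 1)) + - 1 * (theta / (1 + (1 / z) * q ^ (2 * k + 1)))
      = - ((1 - z) * theta * ((1 - q ^ (2 * k + 1)) / denom k))"
  proof -
    define x where "x = q ^ (2 * k + 1)"
    define a b where "a = 1 + z * x" and "b = 1 + x / z"
    have ab: "a \<noteq> 0" "b \<noteq> 0" using pole1[of k] pole2[of k] by (auto simp: a_def b_def x_def)
    have zb: "z * b = z + x" using z0 by (simp add: b_def field_simps)
    have "z / a - 1 / b = (z * b - a) / (a * b)"
      using ab by (simp add: diff_frac_eq mult.commute)
    also have "z * b - a = - ((1 - z) * (1 - x))"
      unfolding zb a_def by (simp add: algebra_simps)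
    finally have eq: "z / a - 1 / b = - ((1 - z) * (1 - x)) / (a * b)" .
    have "z * t / a + - 1 * (t / b) = - ((1 - z) * t * ((1 - x) / (a * b)))" for t
    proof -
      have "z * t / a + - 1 * (t / b) = t * (z / a - 1 / b)"
        by (simp add: right_diff_distrib)
      then show ?thesis unfolding eq by simp
    qed
    moreover have "1 + (1 / z) * x = b" by (simp add: b_def)
    ultimately show ?thesis
      unfolding denom_def x_def[symmetric] a_def[symmetric] b_def[symmetric] by (simp only:)
  qed
  finally show ?thesis .
qed

text \<open>\<open>lerch_coeff_bound\<close> is uniform in k, so |q|^k times a theta majorant in n
  dominates the double series and the k and n sums can be exchanged.\<close>

lemma lerch_double_sum:
  defines "P \<equiv> (\<lambda>n. lerch_total q n * (z powi n - z powi (- n)))"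
  shows "(P has_sum (\<Sum>\<^sub>\<infinity>k. - ((1 - z) * theta) * lerch_summand k)) UNIV"
proof -
  define c where "c k = (- 1) ^ k * q ^ (Suc k ^ 2)" for k :: nat
  define G where "G = (\<lambda>(k, n). c k * (lerch_coeff q k n * (z powi n - z powi (- n))))"
  define K where "K = (\<Sum>\<^sub>\<infinity>r. norm q powi tri r)"
  have K: "K \<ge> 0" unfolding K_def by (rule infsum_nonneg) simp
  define M where "M n = K * (norm (z powi n * q powi tri n) + norm (inverse z powi n * q powi tri n))" for n
  have "M summable_on UNIV"
    unfolding M_def by (intro summable_on_cmult_right summable_on_add theta_abs_summable q0 q1) (use z0 in auto)
  moreover have geom: "(\<lambda>k. norm q ^ k) summable_on UNIV"
    using q1 by (intro norm_summable_imp_summable_on) (simp add: summable_geometric)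
  moreover have "M n \<ge> 0" for n using K by (simp add: M_def)
  ultimately have "(\<lambda>(k, n). norm q ^ k * M n) summable_on UNIV \<times> UNIV"
    by (intro summable_on_product_real) simp_all
  then have "(\<lambda>x. norm (G x)) summable_on UNIV \<times> UNIV"
  proof (rule Infinite_Sum.abs_summable_on_comparison_test')
    fix x :: "nat \<times> int"
    obtain k n where x: "x = (k, n)" by (cases x)
    have "k \<le> Suc k ^ 2" by (simp add: power2_eq_square)
    then have 1: "norm (c k) \<le> norm q ^ k"
      using q1 by (simp add: c_def norm_mult norm_power power_decreasing del: power_Suc)
    have "norm (lerch_coeff q k n) * norm (z powi n - z powi (- n))
        \<le> (K * norm q powi tri n) * (norm (z powi n) + norm (z powi (- n)))"
      using lerch_coeff_bound[OF q0 q1, of k n] K norm_triangle_ineq4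
      by (intro mult_mono) (auto simp: K_def)
    also have "\<dots> = M n"
      by (simp add: M_def norm_mult norm_power_int power_int_minus power_int_inverse norm_inverse algebra_simps)
    finally show "norm (G x) \<le> (case x of (k, n) \<Rightarrow> norm q ^ k * M n)"
      unfolding x G_def prod.case norm_mult using 1 by (intro mult_mono) auto
  qed
  then have "G summable_on UNIV \<times> UNIV"
    by (rule abs_summable_summable)
  then have G: "(G has_sum infsum G (UNIV \<times> UNIV)) (UNIV \<times> UNIV)" by simp
  have "((\<lambda>k. - ((1 - z) * theta) * lerch_summand k) has_sum infsum G (UNIV \<times> UNIV)) UNIV"
  proof (rule has_sum_SigmaD[OF G])
    fix k :: nat
    have "((\<lambda>n. G (k, n)) has_sum c k * - ((1 - z) * theta * ((1 - q ^ (2 * k + 1)) / denom k))) UNIV"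
      unfolding G_def prod.case by (intro has_sum_cmult_right lerch_coeff_has_sum_diff)
    also have "c k * - ((1 - z) * theta * ((1 - q ^ (2 * k + 1)) / denom k)) = - ((1 - z) * theta) * lerch_summand k"
      unfolding c_def lerch_summand_def by (simp only: divide_inverse mult_minus_left mult_minus_right mult_ac)
    finally show "((\<lambda>n. G (k, n)) has_sum - ((1 - z) * theta) * lerch_summand k) UNIV" .
  qed
  then have total: "(\<Sum>\<^sub>\<infinity>k. - ((1 - z) * theta) * lerch_summand k) = infsum G (UNIV \<times> UNIV)"
    by (rule infsumI)
  have "((\<lambda>(n, k). G (k, n)) has_sum infsum G (UNIV \<times> UNIV)) (UNIV \<times> UNIV)"
    using G by (subst (asm) has_sum_swap)
  then have "(P has_sum infsum G (UNIV \<times> UNIV)) UNIV"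
  proof (rule has_sum_SigmaD)
    fix n :: int
    have "(\<lambda>k. norm (c k * lerch_coeff q k n)) summable_on UNIV"
    proof (rule Infinite_Sum.abs_summable_on_comparison_test')
      show "(\<lambda>k. norm q ^ k * (K * norm q powi tri n)) summable_on UNIV"
        by (rule summable_on_cmult_left[OF geom])
      fix k
      have "k \<le> Suc k ^ 2" by (simp add: power2_eq_square)
      then have "norm (c k) \<le> norm q ^ k"
        using q1 by (simp add: c_def norm_mult norm_power power_decreasing del: power_Suc)
      then show "norm (c k * lerch_coeff q k n) \<le> norm q ^ k * (K * norm q powi tri n)"
        unfolding norm_mult using lerch_coeff_bound[OF q0 q1, of k n]
        by (intro mult_mono) (auto simp: K_def)
    qed
    then have "((\<lambda>k. c k * lerch_coeff q k n) has_sum lerch_total q n) UNIV"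
      unfolding lerch_total_def[OF q0 q1] c_def by (rule has_sum_infsum[OF abs_summable_summable])
    then have "((\<lambda>k. c k * lerch_coeff q k n * (z powi n - z powi (- n))) has_sum P n) UNIV"
      unfolding P_def by (rule has_sum_cmult_left)
    then show "((\<lambda>k. case (n, k) of (n, k) \<Rightarrow> G (k, n)) has_sum P n) UNIV"
      by (simp add: G_def mult.assoc)
  qed
  then show ?thesis unfolding total .
qed

text \<open>z^n - z^(-n) is odd in n and vanishes at 0, so the terms n and -n pair into the
  difference evaluated by \<open>lerch_total_antisym\<close>.\<close>

lemma lerch_double_sum_folded:
  "((\<lambda>n. q powi (n ^ 2) * inv_theta_sum q n / conj_bailey_const q * (z powi n - z powi (- n)))
    has_sum (\<Sum>\<^sub>\<infinity>k. - ((1 - z) * theta) * lerch_summand k)) {1..}"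
proof -
  define P where "P n = lerch_total q n * (z powi n - z powi (- n))" for n
  define S where "S = (\<Sum>\<^sub>\<infinity>k. - ((1 - z) * theta) * lerch_summand k)"
  have P: "(P has_sum S) UNIV"
    unfolding P_def[abs_def] S_def by (rule lerch_double_sum)
  have smr: "P summable_on A" for A
    by (rule summable_on_subset[OF has_sum_imp_summable[OF P]]) auto
  have pos: "(P has_sum infsum P {1..}) {1..}" using smr by simp
  have "(P has_sum infsum P {..-1}) {..-1}" using smr by simp
  then have neg: "((\<lambda>n. P (- n)) has_sum infsum P {..-1}) {1..}"
    by (subst has_sum_reindex_bij_witness[of _ uminus uminus "{..-1}" P]) auto
  have "(P has_sum (infsum P {1..} + infsum P {..-1})) ({1..} \<union> {..-1})"
    by (intro has_sum_Un_disjoint has_sum_infsum smr) auto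
  also have "?this \<longleftrightarrow> (P has_sum (infsum P {1..} + infsum P {..-1})) UNIV"
  proof (rule has_sum_cong_neutral)
    fix n assume "n \<in> UNIV - ({1..} \<union> {..-1 :: int})"
    then have "n = 0" by auto
    then show "P n = 0" by (simp add: P_def)
  qed auto
  finally have "S = infsum P {1..} + infsum P {..-1}"
    using P has_sum_unique by blast
  then have "((\<lambda>n. P n + P (- n)) has_sum S) {1..}"
    using has_sum_add[OF pos neg] by simp
  also have "(\<lambda>n. P n + P (- n)) = (\<lambda>n. (lerch_total q n - lerch_total q (- n)) * (z powi n - z powi (- n)))"
    by (simp add: P_def fun_eq_iff algebra_simps)
  finally show ?thesis
    unfolding lerch_total_antisym[OF q0 q1] S_def .
qed

text \<open>\<open>conj_bailey_const\<close> multiplies the Lerch sum in F4 and divides the folded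
  coefficients, so it cancels.\<close>

lemma theta_F4:
  assumes "z \<noteq> 1"
  shows "((\<lambda>n. q powi (n ^ 2) * inv_theta_sum q n * ((z powi n - z powi (- n)) / (1 - z)))
    has_sum theta * F4 z (- q)) {1..}"
proof -
  define A where "A = conj_bailey_const q"
  have A: "A \<noteq> 0" unfolding A_def by (rule conj_bailey_const_nonzero[OF q0 q1])
  define L where "L = infsum lerch_summand UNIV"
  have "F4 z (- q) = - A * L"
    using has_sum_imp_sums[OF F4_term_has_sum] unfolding A_def L_def infsum_cmult_right'
    by (simp add: F4_def sums_iff)
  then have F4: "theta * F4 z (- q) = A / (1 - z) * (- ((1 - z) * theta) * L)"
    using assms by simp
  have "((\<lambda>n. A / (1 - z) * (q powi (n ^ 2) * inv_theta_sum q n / A * (z powi n - z powi (- n))))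
      has_sum A / (1 - z) * (- ((1 - z) * theta) * L)) {1..}"
    using lerch_double_sum_folded unfolding A_def[symmetric] L_def infsum_cmult_right'
    by (rule has_sum_cmult_right)
  also have "(\<lambda>n. A / (1 - z) * (q powi (n ^ 2) * inv_theta_sum q n / A * (z powi n - z powi (- n))))
      = (\<lambda>n. q powi (n ^ 2) * inv_theta_sum q n * ((z powi n - z powi (- n)) / (1 - z)))"
    using A by simp
  finally show ?thesis
    unfolding F4 .
qed

text \<open>For 1 <= j <= n the exponent n^2 - tri j is at least tri n + n. The n values of j cost a
  factor n <= 2^n, absorbed into the argument of a theta series.\<close>

lemma double_sum_summable:
  "(\<lambda>(n, j). q powi (n ^ 2 - tri j) * ((z powi n - z powi (- n)) / (1 - z)))
    summable_on Sigma {1..} (\<lambda>n. {1..n})"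
proof (rule abs_summable_summable, rule Infinite_Sum.abs_summable_on_comparison_test')
  define r y where "r = norm q" and "y = norm z"
  have ry: "0 < r" "r < 1" "0 < y" using q0 q1 z0 by (auto simp: r_def y_def)
  define w where "w n = r powi (tri n + n) * ((y powi n + y powi (- n)) / norm (1 - z))" for n
  have w: "w n \<ge> 0" for n
    using ry by (simp add: w_def)
  show "(\<lambda>(n, j). w n) summable_on Sigma {1..} (\<lambda>n. {1..n})"
  proof (rule summable_on_SigmaI)
    fix n :: int assume "n \<in> {1..}"
    then show "((\<lambda>j. case (n, j) of (n, j) \<Rightarrow> w n) has_sum of_int n * w n) {1..n}"
      by (intro has_sum_finiteI) auto
  next
    have "(\<lambda>n. inverse (norm (1 - z)) * ((2 * r * y) powi n * r powi tri n + (2 * r / y) powi n * r powi tri n)) summable_on UNIV"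
      using ry by (intro summable_on_cmult_right summable_on_add theta_summable_real) auto
    then have s: "(\<lambda>n. inverse (norm (1 - z)) * ((2 * r * y) powi n * r powi tri n + (2 * r / y) powi n * r powi tri n)) summable_on {1..}"
      by (rule summable_on_subset) auto
    show "(\<lambda>n. of_int n * w n) summable_on {1..}"
    proof (rule summable_on_comparison_test[OF s])
      fix n :: int assume n: "n \<in> {1..}"
      have "of_int n \<le> (2 :: real) powi n"
        using n of_nat_less_two_power[of "nat n", where 'a = real]
        by (simp add: power_int_nonneg_exp)
      then have "of_int n * w n \<le> 2 powi n * w n"
        using w by (intro mult_right_mono) auto
      also have "\<dots> = inverse (norm (1 - z)) * ((2 * r * y) powi n * r powi tri n + (2 * r / y) powi n * r powi tri n)"
        using ry by (simp add: w_def power_int_add power_int_mult_distrib power_int_inverse power_int_minus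
            divide_inverse algebra_simps)
      finally show "of_int n * w n \<le> \<dots>" .
    qed (use w in auto)
  qed (use w in auto)
  fix x :: "int \<times> int"
  assume "x \<in> Sigma {1..} (\<lambda>n. {1..n})"
  then obtain n j where x: "x = (n, j)" and nj: "1 \<le> j" "j \<le> n" by (cases x) auto
  have "2 * tri j \<le> 2 * tri n"
    unfolding tri_double using nj by (intro mult_mono) auto
  then have "r powi (n ^ 2 - tri j) \<le> r powi (tri n + n)"
    using ry by (intro power_int_decreasing) (auto simp: tri_square)
  moreover have "norm (z powi n - z powi (- n)) \<le> y powi n + y powi (- n)"
    using norm_triangle_ineq4[of "z powi n" "z powi (- n)"] by (simp add: norm_power_int y_def)
  ultimately show "norm (case x of (n, j) \<Rightarrow> q powi (n ^ 2 - tri j) * ((z powi n - z powi (- n)) / (1 - z)))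
      \<le> (case x of (n, j) \<Rightarrow> w n)"
    unfolding x prod.case w_def norm_mult norm_divide norm_power_int r_def[symmetric]
    using ry by (intro mult_mono divide_right_mono) auto
qed

end

text \<open>\<open>F4_defined\<close> keeps z off the poles -q^(2k+1) and -q^(-(2k+1)), where HOL
  division by zero would give 0. Summability is asserted as well because \<open>suminf\<close> and
  \<open>infsum\<close> are total.\<close>

theorem theorem3p3:
  fixes q z :: complex
  assumes "0 < norm q" and "norm q < 1"
    and "z \<noteq> 0" and "z \<noteq> 1"
    and F4_defined: "\<And>n::nat. qpochs [z * (- q), (- q) / z] ((- q) ^ 2) (n + 1) \<noteq> 0"
  shows "summable (F4_term z (- q)) \<and>
    (\<lambda>(n, j). q powi (n ^ 2 - (j * (j - 1)) div 2) * ((z powi n - z powi (- n)) / (1 - z)))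
      summable_on {(n :: int, j :: int). 1 \<le> j \<and> j \<le> n} \<and>
    qpochs_inf [- z * q, - 1 / z, q] q * F4 z (- q) =
      (\<Sum>\<^sub>\<infinity>(n, j) \<in> {(n :: int, j :: int). 1 \<le> j \<and> j \<le> n}.
         q powi (n ^ 2 - (j * (j - 1)) div 2) * ((z powi n - z powi (- n)) / (1 - z)))"
proof -
  have q0: "q \<noteq> 0" using assms(1) by auto
  \<comment> \<open>The product for \<open>n = k\<close> has k + 1 factors and so contains the
    k-th.\<close>
  have factors: "1 - z * (- q) * ((- q) ^ 2) ^ k \<noteq> 0" "1 - (- q) / z * ((- q) ^ 2) ^ k \<noteq> 0" for k
    using F4_defined[of k] by (auto simp: qpochs_def qpoch_def)
  have pole1: "1 + z * q ^ (2 * k + 1) \<noteq> 0" for k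
    using factors(1)[of k] by (simp add: power_mult mult.assoc)
  have pole2: "1 + q ^ (2 * k + 1) / z \<noteq> 0" for k
    using factors(2)[of k] by (simp add: power_mult)
  note ctx = q0 assms(2,3) pole1 pole2
  define f where "f = (\<lambda>(n, j). q powi (n ^ 2 - tri j) * ((z powi n - z powi (- n)) / (1 - z)))"
  have set: "{(n :: int, j :: int). 1 \<le> j \<and> j \<le> n} = Sigma {1..} (\<lambda>n. {1..n})"
    by auto
  have f: "f summable_on Sigma {1..} (\<lambda>n. {1..n})"
    unfolding f_def by (rule double_sum_summable[OF ctx])
  have "((\<lambda>n. q powi (n ^ 2) * inv_theta_sum q n * ((z powi n - z powi (- n)) / (1 - z)))
      has_sum infsum f (Sigma {1..} (\<lambda>n. {1..n}))) {1..}"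
  proof (rule has_sum_SigmaD)
    show "(f has_sum infsum f (Sigma {1..} (\<lambda>n. {1..n}))) (Sigma {1..} (\<lambda>n. {1..n}))"
      using f by simp
    fix n :: int assume n: "n \<in> {1..}"
    have "(\<Sum>j\<in>{1..n}. f (n, j)) = (\<Sum>j\<in>{1..n}. q powi (n ^ 2) * q powi (- tri j) * ((z powi n - z powi (- n)) / (1 - z)))"
      unfolding f_def prod.case using q0 by (intro sum.cong refl) (simp add: power_int_diff power_int_minus divide_inverse)
    also have "\<dots> = q powi (n ^ 2) * inv_theta_sum q n * ((z powi n - z powi (- n)) / (1 - z))"
      using n unfolding sum_distrib_left[symmetric] sum_distrib_right[symmetric]
      by (simp add: inv_theta_sum_def[OF q0 assms(2)])
    finally show "((\<lambda>j. f (n, j)) has_sum q powi (n ^ 2) * inv_theta_sum q n * ((z powi n - z powi (- n)) / (1 - z))) {1..n}"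
      by (intro has_sum_finiteI) auto
  qed
  then have "qpochs_inf [- z * q, - 1 / z, q] q * F4 z (- q) = infsum f (Sigma {1..} (\<lambda>n. {1..n}))"
    using has_sum_unique[OF theta_F4[OF ctx assms(4)]] by blast
  moreover have "summable (F4_term z (- q))"
    using has_sum_imp_sums[OF F4_term_has_sum[OF ctx]] by (rule sums_summable)
  ultimately show ?thesis
    using f unfolding set f_def tri_def by blast
qed

end
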